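(* Consider a one-body quantum flow determined by $(\rho,S)$, with $\rho_m,\eta,\zeta,P,p,\mathbf u,\mathbf v,\mathbf w=\mathbf u+\mathbf v$ as in the context and a real potential $U$, satisfying the continuity equation $\partial\rho+\nabla\cdot(\rho\mathbf v)=0$. Let $\mathbb V\subset\mathbb R^3$ be the region occupied by a fluid particle (moving with velocity $\mathbf w$) of the flow, and suppose the flow satisfies the Euler equation $$\partial(\rho_m\mathbf u)+\rho_m\partial\mathbf v+\tfrac12\rho_m\nabla(|\mathbf u|^2+|\mathbf v|^2)+\nabla(P+p)+\nabla\cdot(\rho_m\mathbf u)\,\mathbf u+\rho\nabla U=\mathbf 0 .$$ Let $\mathcal P=-p$. Then $$\mathcal D\!\int_{\mathbb V}\rho_m\mathbf w=\int_{\mathbb V}\Big[-\nabla P-\rho\nabla U+\nabla\big(\eta\,\nabla\cdot\mathbf v\big)+\frac1\zeta\Big(P\mathbf v+\mathcal P\mathbf u+(\mathbf v\cdot\mathbf u)\,\rho_m\mathbf u\Big)\Big].$$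
   Context: Constants $\hbar,m>0$. $\partial=\partial/\partial t$ and $\nabla$ is the gradient in $\mathbf r\in\mathbb R^3$. $\rho\ge0$ and $S$ are real functions on $\mathbb R\times\mathbb R^3$, with as many derivatives as appear; the zero set of $\rho$ has measure zero for each time. All equalities are understood almost everywhere. Definitions: $\zeta_0=\hbar/2$, $\zeta=\zeta_0/m$, $\rho_m=m\rho$, $\eta=\zeta_0\rho$; $\mathbf v=\frac1m\nabla S$, $\mathbf u=-\zeta\,\nabla\rho/\rho$; $P=\zeta_0\nabla\cdot(\rho\mathbf u)$, $p=-\zeta_0\nabla\cdot(\rho\mathbf v)$. $\mathcal D$ is the total time derivative of the integral over the region $\mathbb V(t)$ carried by the velocity field $\mathbf w$, so $\mathcal D\int_{\mathbb V}\rho_m\mathbf w=\int_{\mathbb V}[\partial(\rho_m\mathbf w)+\rho_m(\mathbf w\cdot\nabla)\mathbf w+\nabla\cdot(\rho_m\mathbf w)\,\mathbf w]$. *)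

theory Defs
  imports "HOL-Analysis.Analysis"
begin

type_synonym space = "real ^ 3"
type_synonym scalar_field = "real \<Rightarrow> space \<Rightarrow> real"
type_synonym vector_field = "real \<Rightarrow> space \<Rightarrow> space"

section \<open>Differential operators\<close>

text \<open>Class \<open>C\<^sup>k\<close>, meant for open \<open>S\<close> in a finite-dimensional space.\<close>

primrec Ck_on :: "nat \<Rightarrow> ('a::euclidean_space \<Rightarrow> 'b::real_normed_vector) \<Rightarrow> 'a set \<Rightarrow> bool" where
  "Ck_on 0 f S \<longleftrightarrow> continuous_on S f"
| "Ck_on (Suc k) f S \<longleftrightarrow> (\<forall>x\<in>S. f differentiable at x) \<and>
     (\<forall>h. Ck_on k (\<lambda>x. frechet_derivative f (at x) h) S)"

text \<open>The operators below have unspecified values where the derivative does not exist.\<close>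

definition grad :: "(space \<Rightarrow> real) \<Rightarrow> space \<Rightarrow> space" where
  "grad f x = (THE D. GDERIV f x :> D)"

definition dvg :: "(space \<Rightarrow> space) \<Rightarrow> space \<Rightarrow> real" where
  "dvg F x = trace (jacobian F (at x))"

definition advect :: "space \<Rightarrow> (space \<Rightarrow> space) \<Rightarrow> space \<Rightarrow> space" where  \<comment> \<open>\<open>(a \<cdot> \<nabla>) F\<close>\<close>
  "advect a F x = jacobian F (at x) *v a"

definition dt :: "(real \<Rightarrow> space \<Rightarrow> 'b::real_normed_vector) \<Rightarrow> real \<Rightarrow> space \<Rightarrow> 'b" where
  "dt F t x = vector_derivative (\<lambda>\<tau>. F \<tau> x) (at t)"

section \<open>The quantum flow determined by \<open>\<rho>\<close> and \<open>S\<close>\<close>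

definition zeta0 :: "real \<Rightarrow> real" where
  "zeta0 hbar = hbar / 2"

definition zeta :: "real \<Rightarrow> real \<Rightarrow> real" where
  "zeta hbar m = zeta0 hbar / m"

definition mass_density :: "real \<Rightarrow> scalar_field \<Rightarrow> scalar_field" where
  "mass_density m \<rho> t x = m * \<rho> t x"

definition eta :: "real \<Rightarrow> scalar_field \<Rightarrow> scalar_field" where
  "eta hbar \<rho> t x = zeta0 hbar * \<rho> t x"

definition vel_v :: "real \<Rightarrow> scalar_field \<Rightarrow> vector_field" where
  "vel_v m S t x = (1 / m) *\<^sub>R grad (S t) x"

definition vel_u :: "real \<Rightarrow> real \<Rightarrow> scalar_field \<Rightarrow> vector_field" where
  "vel_u hbar m \<rho> t x = - zeta hbar m *\<^sub>R (grad (\<rho> t) x /\<^sub>R \<rho> t x)"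

definition vel_w :: "real \<Rightarrow> real \<Rightarrow> scalar_field \<Rightarrow> scalar_field \<Rightarrow> vector_field" where
  "vel_w hbar m \<rho> S t x = vel_u hbar m \<rho> t x + vel_v m S t x"

definition P_u :: "real \<Rightarrow> real \<Rightarrow> scalar_field \<Rightarrow> scalar_field" where  \<comment> \<open>the scalar \<open>P\<close>\<close>
  "P_u hbar m \<rho> t x = zeta0 hbar * dvg (\<lambda>y. \<rho> t y *\<^sub>R vel_u hbar m \<rho> t y) x"

definition p_v :: "real \<Rightarrow> real \<Rightarrow> scalar_field \<Rightarrow> scalar_field \<Rightarrow> scalar_field" where  \<comment> \<open>the scalar \<open>p\<close>\<close>
  "p_v hbar m \<rho> S t x = - zeta0 hbar * dvg (\<lambda>y. \<rho> t y *\<^sub>R vel_v m S t y) x"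

text \<open>Regularity: exactly the derivatives occurring in the equations, namely
  \<open>\<partial>\<rho>\<close>, \<open>\<partial>\<nabla>\<rho>\<close>, \<open>\<partial>\<nabla>S\<close> and the spatial ones up to order three, exist and are continuous.\<close>

definition regular_flow :: "scalar_field \<Rightarrow> scalar_field \<Rightarrow> bool" where
  "regular_flow \<rho> S \<longleftrightarrow>
     Ck_on 1 (\<lambda>(t, x). \<rho> t x) UNIV \<and>
     Ck_on 1 (\<lambda>(t, x). grad (\<rho> t) x) UNIV \<and>
     Ck_on 1 (\<lambda>(t, x). grad (S t) x) UNIV \<and>
     (\<forall>t. Ck_on 3 (\<rho> t) UNIV \<and> Ck_on 3 (S t) UNIV)"

definition continuity_eq :: "real \<Rightarrow> scalar_field \<Rightarrow> scalar_field \<Rightarrow> bool" where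
  "continuity_eq m \<rho> S \<longleftrightarrow>
     (\<forall>t. AE x in lebesgue. dt \<rho> t x + dvg (\<lambda>y. \<rho> t y *\<^sub>R vel_v m S t y) x = 0)"

definition euler_eq ::
  "real \<Rightarrow> real \<Rightarrow> scalar_field \<Rightarrow> scalar_field \<Rightarrow> scalar_field \<Rightarrow> bool" where
  "euler_eq hbar m \<rho> S U \<longleftrightarrow>
    (let \<rho>m = mass_density m \<rho>; u = vel_u hbar m \<rho>; v = vel_v m S;
         P = P_u hbar m \<rho>; p = p_v hbar m \<rho> S
     in \<forall>t. AE x in lebesgue.
       dt (\<lambda>\<tau> y. \<rho>m \<tau> y *\<^sub>R u \<tau> y) t x
       + \<rho>m t x *\<^sub>R dt v t x
       + (1 / 2 * \<rho>m t x) *\<^sub>R grad (\<lambda>y. (norm (u t y))\<^sup>2 + (norm (v t y))\<^sup>2) x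
       + grad (\<lambda>y. P t y + p t y) x
       + dvg (\<lambda>y. \<rho>m t y *\<^sub>R u t y) x *\<^sub>R u t x
       + \<rho> t x *\<^sub>R grad (U t) x = 0)"

section \<open>Regions carried by a velocity field\<close>

text \<open>
  \<open>X \<tau> x\<close> is the position at time \<open>\<tau>\<close> of the particle that is at \<open>x\<close> at the reference
  time \<open>t0\<close>; \<open>D \<tau>\<close> is the set of points where the velocity field \<open>w \<tau>\<close> is defined.
\<close>

definition motion_on ::
  "vector_field \<Rightarrow> (real \<Rightarrow> space set) \<Rightarrow> real set \<Rightarrow> real \<Rightarrow> space set \<Rightarrow> vector_field \<Rightarrow> bool" where
  "motion_on w D I t0 \<Omega> X \<longleftrightarrow>
     open I \<and> is_interval I \<and> t0 \<in> I \<and> open \<Omega> \<and>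
     Ck_on 1 (\<lambda>(\<tau>, x). X \<tau> x) (I \<times> \<Omega>) \<and>
     (\<forall>\<tau>\<in>I. inj_on (X \<tau>) \<Omega> \<and> X \<tau> ` \<Omega> \<subseteq> D \<tau>) \<and>
     (\<forall>x\<in>\<Omega>. X t0 x = x \<and>
        (\<forall>\<tau>\<in>I. ((\<lambda>s. X s x) has_vector_derivative w \<tau> (X \<tau> x)) (at \<tau>)))"

definition carried_region ::
  "vector_field \<Rightarrow> (real \<Rightarrow> space set) \<Rightarrow> real set \<Rightarrow> (real \<Rightarrow> space set) \<Rightarrow> bool" where
  "carried_region w D I V \<longleftrightarrow>
     (\<exists>t0 \<Omega> X. motion_on w D I t0 \<Omega> X \<and>
        V t0 \<in> sets lebesgue \<and> bounded (V t0) \<and> closure (V t0) \<subseteq> \<Omega> \<and>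
        (\<forall>\<tau>\<in>I. V \<tau> = X \<tau> ` V t0))"

text \<open>
  The integrand of the transport formula for the total time derivative of the integral of
  \<open>\<rho>m w\<close> over a region carried by \<open>w\<close>. It is used for regions that meet the zero set of
  the density, where \<open>w\<close> is singular and no classical motion exists.
\<close>

definition transport_rate :: "scalar_field \<Rightarrow> vector_field \<Rightarrow> vector_field" where
  "transport_rate \<rho>m w t x =
     dt (\<lambda>\<tau> y. \<rho>m \<tau> y *\<^sub>R w \<tau> y) t x
     + \<rho>m t x *\<^sub>R advect (w t x) (w t) x
     + dvg (\<lambda>y. \<rho>m t y *\<^sub>R w t y) x *\<^sub>R w t x"

definition momentum_source ::
  "real \<Rightarrow> real \<Rightarrow> scalar_field \<Rightarrow> scalar_field \<Rightarrow> scalar_field \<Rightarrow> vector_field" where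
  "momentum_source hbar m \<rho> S U t x =
    (let \<rho>m = mass_density m \<rho>; u = vel_u hbar m \<rho>; v = vel_v m S;
         P = P_u hbar m \<rho>; PP = (\<lambda>t x. - p_v hbar m \<rho> S t x)
     in - grad (P t) x - \<rho> t x *\<^sub>R grad (U t) x
        + grad (\<lambda>y. eta hbar \<rho> t y * dvg (v t) y) x
        + (1 / zeta hbar m) *\<^sub>R
            (P t x *\<^sub>R v t x + PP t x *\<^sub>R u t x + ((v t x \<bullet> u t x) * \<rho>m t x) *\<^sub>R u t x))"

end

theory Submission
  imports Defs
begin

text \<open>
  The transport theorem is obtained by pulling the integral over the carried region back to the
  reference region. The interchange of mixed partial derivatives gives the variational equation
  for the spatial derivative of the motion, hence Jacobi's formula
  \<open>\<partial> det DX = (\<nabla> \<cdot> w) det DX\<close>, and one differentiates under the integral sign.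

  The rest is a pointwise identity where \<open>\<rho> > 0\<close>. Both \<open>u\<close> and \<open>v\<close> have symmetric Jacobians, so
  \<open>(w \<cdot> \<nabla>) w = \<nabla>(|u|\<^sup>2 + |v|\<^sup>2) / 2 + \<nabla>(u \<cdot> v)\<close>. Inserting the Euler and continuity equations
  leaves \<open>-\<nabla>(P + p) - \<rho> \<nabla>U + \<rho>m \<nabla>(u \<cdot> v) + (P v - p u) / \<zeta>\<close>, and since \<open>\<nabla>\<rho> = - \<rho> u / \<zeta>\<close>, the
  product rule turns \<open>-\<nabla>p\<close> into
  \<open>\<nabla>(\<eta> \<nabla> \<cdot> v) - \<rho>m \<nabla>(u \<cdot> v) + (u \<cdot> v) \<rho>m u / \<zeta>\<close>.
\<close>

section \<open>Mixed partial derivatives\<close>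

text \<open>An asymmetric Schwarz theorem: only one mixed derivative \<open>\<Gamma>\<close> is
  given, and differentiability of \<open>c\<close> in the other order is part of the conclusion. The
  mean value inequality, used once in \<open>s\<close> and once in \<open>\<theta>\<close>, bounds
  the second difference divided by \<open>\<epsilon>\<close> uniformly in \<open>\<epsilon>\<close>;
  then \<open>\<epsilon>\<close> tends to 0 from the right.\<close>

lemma mixed_partials:
  fixes \<Phi> \<Psi> \<Gamma> :: "real \<Rightarrow> real \<Rightarrow> 'b::real_normed_vector"
  assumes "\<delta> > 0"
    and \<Psi>: "\<And>s \<theta>. \<bar>s - \<tau>\<bar> < \<delta> \<Longrightarrow> \<bar>\<theta>\<bar> < \<delta> \<Longrightarrow>
          ((\<lambda>s. \<Phi> s \<theta>) has_vector_derivative \<Psi> s \<theta>) (at s)"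
    and \<Gamma>: "\<And>s \<theta>. \<bar>s - \<tau>\<bar> < \<delta> \<Longrightarrow> \<bar>\<theta>\<bar> < \<delta> \<Longrightarrow>
          (\<Psi> s has_vector_derivative \<Gamma> s \<theta>) (at \<theta>)"
    and cont: "isCont (\<lambda>(s, \<theta>). \<Gamma> s \<theta>) (\<tau>, 0)"
    and c: "\<And>s. \<bar>s - \<tau>\<bar> < \<delta> \<Longrightarrow> (\<Phi> s has_vector_derivative c s) (at 0)"
  shows "(c has_vector_derivative \<Gamma> \<tau> 0) (at \<tau>)"
proof -
  have "\<exists>d>0. \<forall>s. norm (s - \<tau>) < d \<longrightarrow>
      norm (c s - c \<tau> - (s - \<tau>) *\<^sub>R \<Gamma> \<tau> 0) \<le> e * norm (s - \<tau>)" if "e > 0" for e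
  proof -
    obtain r where r: "r > 0"
      and near: "\<And>s \<theta>. dist (s, \<theta>) (\<tau>, 0) < r \<Longrightarrow> dist (\<Gamma> s \<theta>) (\<Gamma> \<tau> 0) < e"
      using cont \<open>e > 0\<close> unfolding continuous_at_eps_delta by fastforce
    \<comment> \<open>Half of \<open>r\<close>, because the distance in the plane is estimated by
      the sum of the two coordinate distances.\<close>
    define d where "d = min \<delta> (r / 2)"
    have d: "d > 0" "d \<le> \<delta>" using \<open>\<delta> > 0\<close> r by (auto simp: d_def)
    have near': "norm (\<Gamma> s \<theta> - \<Gamma> \<tau> 0) \<le> e" if "\<bar>s - \<tau>\<bar> < d" "\<bar>\<theta>\<bar> < d" for s \<theta>
    proof -
      have "dist (s, \<theta>) (\<tau>, 0) \<le> \<bar>s - \<tau>\<bar> + \<bar>\<theta>\<bar>"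
        using sqrt_sum_squares_le_sum_abs[of "s - \<tau>" \<theta>] by (simp add: dist_Pair_Pair dist_real_def)
      also have "\<dots> < r" using that by (simp add: d_def)
      finally show ?thesis using near[of s \<theta>] by (simp add: dist_norm)
    qed
    have quot: "norm ((1 / \<epsilon>) *\<^sub>R (\<Phi> s \<epsilon> - \<Phi> s 0) - (1 / \<epsilon>) *\<^sub>R (\<Phi> \<tau> \<epsilon> - \<Phi> \<tau> 0) - (s - \<tau>) *\<^sub>R \<Gamma> \<tau> 0)
        \<le> e * norm (s - \<tau>)" if s: "\<bar>s - \<tau>\<bar> < d" and \<epsilon>: "0 < \<epsilon>" "\<epsilon> < d" for s \<epsilon>
    proof -
      \<comment> \<open>Subtracting the bilinear model of the second difference leaves a function
        with small derivative in \<open>\<sigma>\<close>; that derivative is bounded by the same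
        device in \<open>\<theta>\<close>, through \<open>\<psi>\<close>.\<close>
      define \<phi> where "\<phi> \<sigma> = \<Phi> \<sigma> \<epsilon> - \<Phi> \<sigma> 0 - (\<sigma> * \<epsilon>) *\<^sub>R \<Gamma> \<tau> 0" for \<sigma>
      have "norm (\<phi> s - \<phi> \<tau>) \<le> (e * \<epsilon>) * norm (s - \<tau>)"
      proof (rule differentiable_bound[of "{\<tau> - d<..<\<tau> + d}" _ "\<lambda>\<sigma> h. h *\<^sub>R (\<Psi> \<sigma> \<epsilon> - \<Psi> \<sigma> 0 - \<epsilon> *\<^sub>R \<Gamma> \<tau> 0)"])
        fix \<sigma> assume "\<sigma> \<in> {\<tau> - d<..<\<tau> + d}"
        then have \<sigma>: "\<bar>\<sigma> - \<tau>\<bar> < d" by auto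
        have "((\<lambda>s. \<Phi> s \<epsilon>) has_vector_derivative \<Psi> \<sigma> \<epsilon>) (at \<sigma>)"
             "((\<lambda>s. \<Phi> s 0) has_vector_derivative \<Psi> \<sigma> 0) (at \<sigma>)"
          using \<sigma> \<epsilon> d by (auto intro!: \<Psi>)
        then have "(\<phi> has_vector_derivative \<Psi> \<sigma> \<epsilon> - \<Psi> \<sigma> 0 - \<epsilon> *\<^sub>R \<Gamma> \<tau> 0) (at \<sigma>)"
          unfolding \<phi>_def has_vector_derivative_def
          by (auto intro!: derivative_eq_intros simp: algebra_simps)
        then show "(\<phi> has_derivative (\<lambda>h. h *\<^sub>R (\<Psi> \<sigma> \<epsilon> - \<Psi> \<sigma> 0 - \<epsilon> *\<^sub>R \<Gamma> \<tau> 0))) (at \<sigma> within {\<tau> - d<..<\<tau> + d})"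
          by (simp add: has_vector_derivative_def has_derivative_at_withinI)
        have "norm (\<Psi> \<sigma> \<epsilon> - \<Psi> \<sigma> 0 - (\<epsilon> - 0) *\<^sub>R \<Gamma> \<tau> 0) \<le> norm (\<epsilon> - 0) * e"
        proof -
          define \<psi> where "\<psi> \<theta> = \<Psi> \<sigma> \<theta> - \<theta> *\<^sub>R \<Gamma> \<tau> 0" for \<theta>
          have "norm (\<psi> \<epsilon> - \<psi> 0) \<le> e * norm (\<epsilon> - 0)"
          proof (rule differentiable_bound[of "{-d<..<d}" _ "\<lambda>\<theta> h. h *\<^sub>R (\<Gamma> \<sigma> \<theta> - \<Gamma> \<tau> 0)"])
            fix \<theta> assume "\<theta> \<in> {-d<..<d}"
            then have \<theta>: "\<bar>\<theta>\<bar> < d" by auto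
            have "(\<Psi> \<sigma> has_vector_derivative \<Gamma> \<sigma> \<theta>) (at \<theta>)"
              using \<sigma> \<theta> d by (intro \<Gamma>) auto
            then have "(\<psi> has_vector_derivative \<Gamma> \<sigma> \<theta> - \<Gamma> \<tau> 0) (at \<theta>)"
              unfolding \<psi>_def has_vector_derivative_def
              by (auto intro!: derivative_eq_intros simp: algebra_simps)
            then show "(\<psi> has_derivative (\<lambda>h. h *\<^sub>R (\<Gamma> \<sigma> \<theta> - \<Gamma> \<tau> 0))) (at \<theta> within {-d<..<d})"
              by (simp add: has_vector_derivative_def has_derivative_at_withinI)
            show "onorm (\<lambda>h. h *\<^sub>R (\<Gamma> \<sigma> \<theta> - \<Gamma> \<tau> 0)) \<le> e"
              using near'[OF \<sigma> \<theta>] by (simp add: onorm_scaleR_left onorm_id_le onorm_id bounded_linear_ident)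
          qed (use \<epsilon> in auto)
          then show ?thesis by (simp add: \<psi>_def algebra_simps)
        qed
        then show "onorm (\<lambda>h. h *\<^sub>R (\<Psi> \<sigma> \<epsilon> - \<Psi> \<sigma> 0 - \<epsilon> *\<^sub>R \<Gamma> \<tau> 0)) \<le> e * \<epsilon>"
          using \<epsilon> by (simp add: onorm_scaleR_left onorm_id bounded_linear_ident mult.commute)
      qed (use s d in auto)
      moreover have "(1 / \<epsilon>) *\<^sub>R (\<Phi> s \<epsilon> - \<Phi> s 0) - (1 / \<epsilon>) *\<^sub>R (\<Phi> \<tau> \<epsilon> - \<Phi> \<tau> 0) - (s - \<tau>) *\<^sub>R \<Gamma> \<tau> 0
          = (1 / \<epsilon>) *\<^sub>R (\<phi> s - \<phi> \<tau>)"
        using \<epsilon> by (simp add: \<phi>_def algebra_simps)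
      ultimately show ?thesis using \<epsilon> by (simp add: divide_simps mult_ac)
    qed
    have lim: "((\<lambda>\<epsilon>. (1 / \<epsilon>) *\<^sub>R (\<Phi> s \<epsilon> - \<Phi> s 0)) \<longlongrightarrow> c s) (at_right 0)" if "\<bar>s - \<tau>\<bar> < d" for s
    proof -
      have "(\<Phi> s has_vector_derivative c s) (at 0 within {0<..})"
        using c[of s] that d by (simp add: has_vector_derivative_at_within)
      then have "((\<lambda>\<epsilon>. norm (\<Phi> s \<epsilon> - \<Phi> s 0 - \<epsilon> *\<^sub>R c s) / norm \<epsilon>) \<longlongrightarrow> 0) (at_right 0)"
        by (simp add: has_vector_derivative_def has_derivative_iff_norm)
      moreover have "norm (\<Phi> s \<epsilon> - \<Phi> s 0 - \<epsilon> *\<^sub>R c s) / norm \<epsilon> =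
          norm ((1 / \<epsilon>) *\<^sub>R (\<Phi> s \<epsilon> - \<Phi> s 0) - c s)" if "\<epsilon> > 0" for \<epsilon>
      proof -
        have "(1 / \<epsilon>) *\<^sub>R (\<Phi> s \<epsilon> - \<Phi> s 0) - c s = (1 / \<epsilon>) *\<^sub>R (\<Phi> s \<epsilon> - \<Phi> s 0 - \<epsilon> *\<^sub>R c s)"
          using that by (simp add: algebra_simps)
        then show ?thesis using that by simp
      qed
      ultimately have "((\<lambda>\<epsilon>. norm ((1 / \<epsilon>) *\<^sub>R (\<Phi> s \<epsilon> - \<Phi> s 0) - c s)) \<longlongrightarrow> 0) (at_right 0)"
        by (subst (asm) tendsto_cong) (auto simp: eventually_at_filter)
      then show ?thesis by (simp add: LIM_zero_iff tendsto_norm_zero_iff)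
    qed
    show ?thesis
    proof (intro exI[of _ d] conjI allI impI d(1))
      fix s assume s: "norm (s - \<tau>) < d"
      \<comment> \<open>The bound in \<open>quot\<close> does not depend on
        \<open>\<epsilon>\<close>, so it survives the limit in which the difference quotients become
        \<open>c s\<close> and \<open>c \<tau>\<close>.\<close>
      have "((\<lambda>\<epsilon>. norm ((1 / \<epsilon>) *\<^sub>R (\<Phi> s \<epsilon> - \<Phi> s 0) - (1 / \<epsilon>) *\<^sub>R (\<Phi> \<tau> \<epsilon> - \<Phi> \<tau> 0) - (s - \<tau>) *\<^sub>R \<Gamma> \<tau> 0))
          \<longlongrightarrow> norm (c s - c \<tau> - (s - \<tau>) *\<^sub>R \<Gamma> \<tau> 0)) (at_right 0)"
        using s d by (intro tendsto_intros lim) auto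
      moreover have "\<forall>\<^sub>F \<epsilon> in at_right 0. norm ((1 / \<epsilon>) *\<^sub>R (\<Phi> s \<epsilon> - \<Phi> s 0)
          - (1 / \<epsilon>) *\<^sub>R (\<Phi> \<tau> \<epsilon> - \<Phi> \<tau> 0) - (s - \<tau>) *\<^sub>R \<Gamma> \<tau> 0) \<le> e * norm (s - \<tau>)"
        unfolding eventually_at_right_field using quot s d by (intro exI[of _ d]) auto
      ultimately show "norm (c s - c \<tau> - (s - \<tau>) *\<^sub>R \<Gamma> \<tau> 0) \<le> e * norm (s - \<tau>)"
        by (rule tendsto_upperbound) simp
    qed
  qed
  then show ?thesis
    unfolding has_vector_derivative_def has_derivative_at_alt
    by (simp add: bounded_linear_scaleR_left)
qed

section \<open>Calculus of continuously differentiable maps and symmetry of second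
  derivatives\<close>

lemma Ck_on_3_imp_2: "Ck_on 3 f S \<Longrightarrow> Ck_on 2 f S"
  by (auto simp: numeral_3_eq_3 numeral_2_eq_2
      intro!: continuous_at_imp_continuous_on differentiable_imp_continuous_within)

lemma Ck_on_1_I:
  assumes "\<And>z. z \<in> S \<Longrightarrow> (f has_derivative f' z) (at z)"
    and "\<And>h. continuous_on S (\<lambda>z. f' z h)"
  shows "Ck_on 1 f S"
proof -
  have "frechet_derivative f (at z) = f' z" if "z \<in> S" for z
    using frechet_derivative_at[OF assms(1)[OF that]] by simp
  then show ?thesis
    using assms by (auto simp: differentiable_def cong: continuous_on_cong)
qed

lemma Ck_on_1_D:
  assumes "Ck_on 1 f S"
  shows "z \<in> S \<Longrightarrow> (f has_derivative frechet_derivative f (at z)) (at z)"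
    and "continuous_on S (\<lambda>z. frechet_derivative f (at z) h)"
    and "continuous_on S f"
  using assms
  by (auto simp: frechet_derivative_works
      intro!: continuous_at_imp_continuous_on differentiable_imp_continuous_within)

text \<open>\<open>Ck_on\<close> controls a derivative only in each fixed direction. Expanding
  \<open>k s\<close> in the finite basis extends the continuity to directions that vary with
  \<open>s\<close>.\<close>

lemma continuous_on_linear_family:
  fixes L :: "'c::topological_space \<Rightarrow> 'a::euclidean_space \<Rightarrow> 'b::real_normed_vector"
  assumes "\<And>s. s \<in> T \<Longrightarrow> linear (L s)" and "\<And>h. continuous_on T (\<lambda>s. L s h)"
    and k: "continuous_on T k"
  shows "continuous_on T (\<lambda>s. L s (k s))"
proof -
  have "L s (k s) = (\<Sum>b\<in>Basis. (k s \<bullet> b) *\<^sub>R L s b)" if "s \<in> T" for s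
  proof -
    interpret linear "L s" by (rule assms(1)[OF that])
    show ?thesis by (subst (1) euclidean_representation[symmetric]) (simp add: sum scaleR)
  qed
  moreover have "continuous_on T (\<lambda>s. \<Sum>b\<in>Basis. (k s \<bullet> b) *\<^sub>R L s b)"
    by (intro continuous_intros k assms(2))
  ultimately show ?thesis by (simp cong: continuous_on_cong)
qed

text \<open>Derivatives at a moving point in a moving direction are what the chain rule produces
  along particle paths; this gives their continuity.\<close>

lemma Ck_on_1_continuous:
  assumes "Ck_on 1 f S" "continuous_on T a" "a ` T \<subseteq> S" "continuous_on T k"
  shows "continuous_on T (\<lambda>s. frechet_derivative f (at (a s)) (k s))"
proof (rule continuous_on_linear_family)
  show "linear (frechet_derivative f (at (a s)))" if "s \<in> T" for s
    using Ck_on_1_D(1)[OF assms(1), of "a s"] that assms(3) has_derivative_linear by blast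
  show "continuous_on T (\<lambda>s. frechet_derivative f (at (a s)) h)" for h
    by (rule continuous_on_compose2[OF Ck_on_1_D(2)[OF assms(1)] assms(2,3)])
qed (rule assms(4))

lemma Ck_on_1_subset: "Ck_on 1 f S \<Longrightarrow> T \<subseteq> S \<Longrightarrow> Ck_on 1 f T"
  by (auto intro: continuous_on_subset)

lemma Ck_on_1_add:
  assumes "Ck_on 1 f S" "Ck_on 1 g S"
  shows "Ck_on 1 (\<lambda>z. f z + g z) S"
  by (rule Ck_on_1_I[OF has_derivative_add[OF assms[THEN Ck_on_1_D(1)]]])
    (assumption+, intro continuous_on_add Ck_on_1_D(2) assms)

lemma Ck_on_1_scaleR:
  assumes "Ck_on 1 f S" "Ck_on 1 g S"
  shows "Ck_on 1 (\<lambda>z. f z *\<^sub>R g z) S"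
  by (rule Ck_on_1_I[OF has_derivative_scaleR[OF assms[THEN Ck_on_1_D(1)]]])
    (assumption+, intro continuous_on_add continuous_on_scaleR Ck_on_1_D(2,3) assms)

lemma Ck_on_1_const: "Ck_on 1 (\<lambda>z. c) S"
  by (rule Ck_on_1_I[OF has_derivative_const]) (rule continuous_on_const)

lemma Ck_on_1_inverse:
  fixes f :: "'a::euclidean_space \<Rightarrow> real"
  assumes "Ck_on 1 f S" "\<And>z. z \<in> S \<Longrightarrow> f z \<noteq> 0"
  shows "Ck_on 1 (\<lambda>z. inverse (f z)) S"
  by (rule Ck_on_1_I[OF Deriv.has_derivative_inverse[OF assms(2) Ck_on_1_D(1)[OF assms(1)]]])
    (assumption+, intro continuous_intros Ck_on_1_D(2,3) assms, auto simp: assms(2))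

lemma Ck_on_1_const_scaleR: "Ck_on 1 f S \<Longrightarrow> Ck_on 1 (\<lambda>z. c *\<^sub>R f z) S"
  by (rule Ck_on_1_scaleR[OF Ck_on_1_const])

text \<open>Apply \<open>mixed_partials\<close> to
  \<open>f (x + s *\<^sub>R k + \<theta> *\<^sub>R h)\<close>. The resulting derivative of
  \<open>frechet_derivative f (at (x + s *\<^sub>R k)) h\<close> in \<open>s\<close> must agree with
  the one that the chain rule gives.\<close>

lemma frechet_derivative_symmetric:
  fixes f :: "'a::euclidean_space \<Rightarrow> 'b::real_normed_vector"
  assumes f: "Ck_on 2 f UNIV"
  shows "frechet_derivative (\<lambda>y. frechet_derivative f (at y) h) (at x) k =
         frechet_derivative (\<lambda>y. frechet_derivative f (at y) k) (at x) h"
proof -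
  let ?D = "\<lambda>h y. frechet_derivative f (at y) h"
  have f1: "(f has_derivative (\<lambda>h. ?D h y)) (at y)" for y
    using f by (simp add: numeral_2_eq_2 frechet_derivative_works)
  have D1: "Ck_on 1 (?D h) UNIV" for h
    using f by (simp add: numeral_2_eq_2)
  let ?G = "\<lambda>s \<theta>. frechet_derivative (?D k) (at (x + s *\<^sub>R k + \<theta> *\<^sub>R h)) h"
  have "((\<lambda>s. ?D h (x + s *\<^sub>R k)) has_vector_derivative ?G 0 0) (at 0)"
  proof (rule mixed_partials[where \<delta> = 1 and \<Phi> = "\<lambda>s \<theta>. f (x + s *\<^sub>R k + \<theta> *\<^sub>R h)"
        and \<Psi> = "\<lambda>s \<theta>. ?D k (x + s *\<^sub>R k + \<theta> *\<^sub>R h)" and \<Gamma> = ?G])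
    have "continuous_on UNIV (\<lambda>z. ?G (fst z) (snd z))"
      by (rule Ck_on_1_continuous[OF D1]) (auto intro!: continuous_intros)
    then show "isCont (\<lambda>(s, \<theta>). ?G s \<theta>) (0, 0)"
      by (simp add: continuous_on_eq_continuous_at case_prod_unfold)
  next
    fix s \<theta> :: real
    have "((\<lambda>s. x + s *\<^sub>R k + \<theta> *\<^sub>R h) has_derivative (\<lambda>r. r *\<^sub>R k)) (at s)"
      by (auto intro!: derivative_eq_intros)
    from has_derivative_compose[OF this f1]
    show "((\<lambda>s. f (x + s *\<^sub>R k + \<theta> *\<^sub>R h)) has_vector_derivative ?D k (x + s *\<^sub>R k + \<theta> *\<^sub>R h)) (at s)"
      by (simp add: has_vector_derivative_def linear_cmul[OF has_derivative_linear[OF f1]])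
  next
    fix s \<theta> :: real
    have "((\<lambda>\<theta>. x + s *\<^sub>R k + \<theta> *\<^sub>R h) has_derivative (\<lambda>r. r *\<^sub>R h)) (at \<theta>)"
      by (auto intro!: derivative_eq_intros)
    from has_derivative_compose[OF this Ck_on_1_D(1)[OF D1 UNIV_I]]
    show "((\<lambda>\<theta>. ?D k (x + s *\<^sub>R k + \<theta> *\<^sub>R h)) has_vector_derivative ?G s \<theta>) (at \<theta>)"
      by (simp add: has_vector_derivative_def
          linear_cmul[OF has_derivative_linear[OF Ck_on_1_D(1)[OF D1 UNIV_I]]])
  next
    fix s :: real
    have "((\<lambda>\<theta>. x + s *\<^sub>R k + \<theta> *\<^sub>R h) has_derivative (\<lambda>r. r *\<^sub>R h)) (at 0)"
      by (auto intro!: derivative_eq_intros)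
    from has_derivative_compose[OF this f1]
    show "((\<lambda>\<theta>. f (x + s *\<^sub>R k + \<theta> *\<^sub>R h)) has_vector_derivative ?D h (x + s *\<^sub>R k)) (at 0)"
      by (simp add: has_vector_derivative_def linear_cmul[OF has_derivative_linear[OF f1]])
  qed simp
  moreover have "((\<lambda>s. ?D h (x + s *\<^sub>R k)) has_vector_derivative frechet_derivative (?D h) (at x) k) (at 0)"
  proof -
    have "((\<lambda>s. x + s *\<^sub>R k) has_derivative (\<lambda>r. r *\<^sub>R k)) (at 0)"
      by (auto intro!: derivative_eq_intros)
    from has_derivative_compose[OF this Ck_on_1_D(1)[OF D1 UNIV_I]]
    show ?thesis
      by (simp add: has_vector_derivative_def
          linear_cmul[OF has_derivative_linear[OF Ck_on_1_D(1)[OF D1 UNIV_I]]])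
  qed
  ultimately show ?thesis
    using vector_derivative_unique_at by fastforce
qed

section \<open>Differentiation under the integral sign and change of variables\<close>

lemma set_integrable_continuous_compact:
  fixes f :: "'a::euclidean_space \<Rightarrow> 'b::euclidean_space"
  assumes "A \<in> sets lebesgue" "compact K" "A \<subseteq> K" "continuous_on K f"
  shows "set_integrable lebesgue A f"
proof (rule set_integrable_subset)
  have "integrable lborel (\<lambda>x. indicator K x *\<^sub>R f x)"
    by (rule borel_integrable_compact[OF assms(2,4)])
  then show "set_integrable lebesgue K f"
    unfolding set_integrable_def by (subst integrable_completion) (auto dest: borel_measurable_integrable)
qed (use assms in auto)

text \<open>Uniform continuity of \<open>\<phi>'\<close> on a compact time interval times
  \<open>K\<close> makes the first-order remainder small uniformly over \<open>A\<close>, which has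
  finite measure. The compact \<open>K\<close> carries the continuity since \<open>A\<close> itself
  need not be closed; in the application it is the closure of \<open>A\<close>.\<close>

lemma has_vector_derivative_set_lebesgue_integral:
  fixes \<phi> \<phi>' :: "real \<Rightarrow> 'a::euclidean_space \<Rightarrow> 'b::euclidean_space"
  assumes A: "A \<in> sets lebesgue" "compact K" "A \<subseteq> K"
    and t: "open I" "t \<in> I"
    and \<phi>': "\<And>s x. s \<in> I \<Longrightarrow> x \<in> K \<Longrightarrow> ((\<lambda>s. \<phi> s x) has_vector_derivative \<phi>' s x) (at s)"
    and cont: "\<And>s. s \<in> I \<Longrightarrow> continuous_on K (\<phi> s)"
    and cont': "continuous_on (I \<times> K) (\<lambda>(s, x). \<phi>' s x)"
  shows "((\<lambda>s. LINT x:A|lebesgue. \<phi> s x) has_vector_derivative (LINT x:A|lebesgue. \<phi>' t x)) (at t)"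
proof -
  define F where "F s = (LINT x:A|lebesgue. \<phi> s x)" for s
  define F' where "F' = (LINT x:A|lebesgue. \<phi>' t x)"
  note int = set_integrable_continuous_compact[OF A]
  have "A \<in> lmeasurable"
    using A bounded_set_imp_lmeasurable bounded_subset compact_imp_bounded by blast
  then have fin: "emeasure lebesgue A < \<infinity>"
    by (simp add: fmeasurableD2 less_top[symmetric] del: emeasure_completion)
  obtain r where r: "r > 0" "cball t r \<subseteq> I"
    using t open_contains_cball by blast
  have "continuous_on (cball t r \<times> K) (\<lambda>(s, x). \<phi>' s x)"
    by (rule continuous_on_subset[OF cont']) (use r in auto)
  then have uni: "uniformly_continuous_on (cball t r \<times> K) (\<lambda>(s, x). \<phi>' s x)"
    by (intro compact_uniformly_continuous compact_Times A compact_cball)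
  have cont_t: "continuous_on K (\<phi>' t)"
  proof -
    have "continuous_on K (\<lambda>x. case (t, x) of (s, x) \<Rightarrow> \<phi>' s x)"
      by (rule continuous_on_compose2[OF cont']) (use t in \<open>auto intro!: continuous_intros\<close>)
    then show ?thesis by simp
  qed
  have "\<exists>d>0. \<forall>s. norm (s - t) < d \<longrightarrow> norm (F s - F t - (s - t) *\<^sub>R F') \<le> e * norm (s - t)"
    if "e > 0" for e
  proof -
    \<comment> \<open>Adding 1 keeps the denominator positive when \<open>A\<close> is a null
      set.\<close>
    define e' where "e' = e / (measure lebesgue A + 1)"
    have e': "e' > 0" "e' * measure lebesgue A \<le> e"
    proof -
      have "measure lebesgue A + 1 > 0"
        using measure_nonneg[of lebesgue A] by linarith
      then show "e' > 0" "e' * measure lebesgue A \<le> e"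
        using \<open>e > 0\<close> by (simp_all add: e'_def pos_divide_le_eq algebra_simps)
    qed
    obtain d0 where d0: "d0 > 0"
      "\<And>z z'. z \<in> cball t r \<times> K \<Longrightarrow> z' \<in> cball t r \<times> K \<Longrightarrow> dist z' z < d0 \<Longrightarrow>
         dist (case z' of (s, x) \<Rightarrow> \<phi>' s x) (case z of (s, x) \<Rightarrow> \<phi>' s x) < e'"
      using uni e'(1) unfolding uniformly_continuous_on_def by meson
    define d where "d = min d0 r"
    have "norm (F s - F t - (s - t) *\<^sub>R F') \<le> e * norm (s - t)" if s: "norm (s - t) < d" for s
    proof -
      define R where "R x = \<phi> s x - \<phi> t x - (s - t) *\<^sub>R \<phi>' t x" for x
      have I: "\<sigma> \<in> I \<and> \<sigma> \<in> cball t r" if "\<sigma> \<in> {t - d<..<t + d}" for \<sigma>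
        using that r(2) by (auto simp: d_def dist_real_def subset_eq)
      have "norm (R x) \<le> e' * norm (s - t)" if "x \<in> A" for x
      proof -
        have "x \<in> K" using that A by auto
        define \<psi> where "\<psi> \<sigma> = \<phi> \<sigma> x - \<sigma> *\<^sub>R \<phi>' t x" for \<sigma>
        have "norm (\<psi> s - \<psi> t) \<le> e' * norm (s - t)"
        proof (rule differentiable_bound[of "{t - d<..<t + d}" _ "\<lambda>\<sigma> h. h *\<^sub>R (\<phi>' \<sigma> x - \<phi>' t x)"])
          fix \<sigma> assume \<sigma>: "\<sigma> \<in> {t - d<..<t + d}"
          then have "((\<lambda>s. \<phi> s x) has_vector_derivative \<phi>' \<sigma> x) (at \<sigma>)"
            using I \<open>x \<in> K\<close> by (intro \<phi>') auto
          then have "(\<psi> has_vector_derivative \<phi>' \<sigma> x - \<phi>' t x) (at \<sigma>)"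
            unfolding \<psi>_def has_vector_derivative_def
            by (auto intro!: derivative_eq_intros simp: algebra_simps)
          then show "(\<psi> has_derivative (\<lambda>h. h *\<^sub>R (\<phi>' \<sigma> x - \<phi>' t x))) (at \<sigma> within {t - d<..<t + d})"
            by (simp add: has_vector_derivative_def has_derivative_at_withinI)
          have "dist (\<phi>' \<sigma> x) (\<phi>' t x) < e'"
            using d0(2)[of "(t, x)" "(\<sigma>, x)"] I[OF \<sigma>] \<sigma> \<open>x \<in> K\<close> r
            by (auto simp: dist_Pair_Pair dist_real_def d_def)
          then show "onorm (\<lambda>h. h *\<^sub>R (\<phi>' \<sigma> x - \<phi>' t x)) \<le> e'"
            by (simp add: onorm_scaleR_left onorm_id bounded_linear_ident dist_norm)
        qed (use s d0(1) r(1) in \<open>auto simp: d_def\<close>)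
        then show ?thesis by (simp add: \<psi>_def R_def algebra_simps)
      qed
      note bound = this
      have "s \<in> I" using I[of s] s by (auto simp: abs_less_iff)
      have intR: "set_integrable lebesgue A R"
        unfolding R_def by (intro int continuous_intros cont cont_t \<open>s \<in> I\<close> t)
      have "norm (LINT x:A|lebesgue. R x) \<le> (LINT x|lebesgue. indicator A x * (e' * norm (s - t)))"
        unfolding set_lebesgue_integral_def
        by (rule Bochner_Integration.integral_norm_bound_integral)
          (use intR integrable_mult_left[OF integrable_real_indicator[OF A(1) fin]] bound
            in \<open>auto simp: set_integrable_def indicator_def\<close>)
      also have "\<dots> = e' * measure lebesgue A * norm (s - t)"
        using A fin by simp
      also have "\<dots> \<le> e * norm (s - t)"
        using e' by (intro mult_right_mono) auto
      finally have "norm (LINT x:A|lebesgue. R x) \<le> e * norm (s - t)" .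
      moreover have "(LINT x:A|lebesgue. R x) = F s - F t - (s - t) *\<^sub>R F'"
        unfolding R_def F_def F'_def
        by (subst set_integral_diff, intro int continuous_intros cont cont_t \<open>s \<in> I\<close> t,
            intro int continuous_intros cont cont_t,
            subst set_integral_diff)
          (auto intro!: int cont \<open>s \<in> I\<close> t simp: set_integral_scaleR_right)
      ultimately show ?thesis by simp
    qed
    moreover have "d > 0" using d0(1) r(1) by (simp add: d_def)
    ultimately show ?thesis by blast
  qed
  then show ?thesis
    unfolding F_def[symmetric] F'_def[symmetric]
    by (simp add: has_vector_derivative_def has_derivative_at_alt bounded_linear_scaleR_left)
qed

text \<open>Integrability is asked only of the pulled-back integrand, which is continuous on a
  compact set in the application. The change of variables theorem is an equivalence, so
  integrability over the image comes with the equality.\<close>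

lemma set_lebesgue_integral_image:
  fixes f :: "real^'m::{finite,wellorder} \<Rightarrow> real^'n" and T :: "real^'m::_ \<Rightarrow> real^'m::_"
  assumes "A \<in> sets lebesgue" "\<And>x. x \<in> A \<Longrightarrow> (T has_derivative T' x) (at x)" "inj_on T A"
    and int: "set_integrable lebesgue A (\<lambda>x. \<bar>det (matrix (T' x))\<bar> *\<^sub>R f (T x))"
  shows "(LINT y:T ` A|lebesgue. f y) = (LINT x:A|lebesgue. \<bar>det (matrix (T' x))\<bar> *\<^sub>R f (T x))"
proof -
  have "f absolutely_integrable_on (T ` A) \<and>
      integral (T ` A) f = integral A (\<lambda>x. \<bar>det (matrix (T' x))\<bar> *\<^sub>R f (T x))"
    by (subst has_absolute_integral_change_of_variables[symmetric])
      (use assms in \<open>auto intro: has_derivative_at_withinI\<close>)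
  then show ?thesis
    using int by (simp add: set_lebesgue_integral_eq_integral(2))
qed

section \<open>The transport theorem\<close>

text \<open>Jacobi's formula for a solution of the linear equation with coefficient matrix
  \<open>B\<close>. In this form no inverse of \<open>M t\<close> enters, and in dimension three it
  is a polynomial identity in the entries.\<close>

lemma det_has_field_derivative_3:
  fixes M :: "real \<Rightarrow> real ^ 3 ^ 3"
  assumes "\<And>i j. ((\<lambda>s. M s $ i $ j) has_field_derivative (B ** M t) $ i $ j) (at t)"
  shows "((\<lambda>s. det (M s)) has_field_derivative trace B * det (M t)) (at t)"
proof -
  note [derivative_intros] = assms[THEN DERIV_chain2[OF _ DERIV_ident, simplified]]
  show ?thesis
    unfolding det_3
    by (rule derivative_eq_intros assms refl)+
      (simp add: matrix_matrix_mult_def trace_def sum_3 algebra_simps)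
qed

text \<open>The zeros of \<open>J\<close> are harmless, so the Jacobian of a motion need not be shown to be nonzero.\<close>

lemma abs_has_field_derivative_linear:
  fixes J :: "real \<Rightarrow> real"
  assumes "(J has_field_derivative b * J t) (at t)"
  shows "((\<lambda>s. \<bar>J s\<bar>) has_field_derivative b * \<bar>J t\<bar>) (at t)"
proof (cases "J t = 0")
  case True
  \<comment> \<open>At a zero of \<open>J\<close> its derivative vanishes too, and the difference
    quotient of the absolute value has the same modulus as that of \<open>J\<close>.\<close>
  then show ?thesis
    using assms by (simp add: DERIV_def) (rule tendsto_rabs_zero_cancel, drule tendsto_rabs_zero, simp add: abs_divide)
next
  case False
  have "((\<lambda>s. \<bar>J s\<bar>) has_field_derivative sgn (J t) * (b * J t)) (at t)"
    using DERIV_chain2[OF _ assms, of abs "sgn (J t)"] GDERIV_norm[OF False] by (simp add: fun_eq_iff)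
  then show ?thesis by (simp add: abs_sgn mult_ac)
qed

section \<open>Space-time derivatives restricted to slices and curves\<close>

lemma has_derivative_snd_arg:
  assumes "((\<lambda>(s, x). f s x) has_derivative F') (at (s, x))"
  shows "(f s has_derivative (\<lambda>h. F' (0, h))) (at x)"
proof -
  have "((\<lambda>x. (s, x)) has_derivative (\<lambda>h. (0, h))) (at x)"
    by (auto intro!: derivative_eq_intros)
  from has_derivative_compose[OF this assms] show ?thesis by simp
qed

text \<open>The chain rule for the material derivative: following the curve means moving in the
  space-time direction \<open>(1, c')\<close>.\<close>

lemma has_vector_derivative_along_curve:
  assumes "((\<lambda>(s, x). f s x) has_derivative F') (at (s, c s))"
    and "(c has_vector_derivative c') (at s)"
  shows "((\<lambda>s. f s (c s)) has_vector_derivative F' (1, c')) (at s)"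
proof -
  have "((\<lambda>s. (s, c s)) has_derivative (\<lambda>h. (h, h *\<^sub>R c'))) (at s)"
    using assms(2) unfolding has_vector_derivative_def by (auto intro!: derivative_eq_intros)
  from has_derivative_compose[OF this assms(1)]
  have "((\<lambda>s. f s (c s)) has_derivative (\<lambda>h. F' (h *\<^sub>R (1, c')))) (at s)" by simp
  then show ?thesis
    unfolding has_vector_derivative_def
    by (simp only: linear_cmul[OF has_derivative_linear[OF assms(1)]])
qed

lemma dt_eq:
  assumes "((\<lambda>(s, x). f s x) has_derivative F') (at (t, x))"
  shows "dt f t x = F' (1, 0)"
  unfolding dt_def
  using has_vector_derivative_along_curve[of f F' t "\<lambda>_. x", OF assms has_vector_derivative_const]
  by (rule vector_derivative_at)

lemma dvg_eq:
  assumes "(F has_derivative F') (at x)"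
  shows "dvg F x = (\<Sum>i\<in>UNIV. F' (axis i 1) $ i)"
  unfolding dvg_def jacobian_def trace_def frechet_derivative_at[OF assms, symmetric]
  by (simp add: matrix_def)

lemma advect_eq:
  assumes "(F has_derivative F') (at x)"
  shows "advect a F x = F' a"
  unfolding advect_def jacobian_def frechet_derivative_at[OF assms, symmetric]
  by (rule matrix_works) (simp add: linear_matrix_vector_mul_eq has_derivative_linear[OF assms])

text \<open>Along a particle path the absolute Jacobian satisfies a linear equation whose
  coefficient is the divergence of \<open>w\<close>. Hence the derivative of Jacobian times
  \<open>g\<close> is the stated integrand times the same Jacobian, and changing variables back at
  time \<open>t\<close> gives the claim.\<close>

theorem reynolds_transport:
  fixes w g :: vector_field
  assumes motion: "motion_on w D I t0 \<Omega> X"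
    and w: "Ck_on 1 (\<lambda>(s, y). w s y) {(s, y). s \<in> I \<and> y \<in> D s}"
    and g: "Ck_on 1 (\<lambda>(s, y). g s y) {(s, y). s \<in> I \<and> y \<in> D s}"
    and A: "A \<in> sets lebesgue" "bounded A" "closure A \<subseteq> \<Omega>" and t: "t \<in> I"
  shows "((\<lambda>s. LINT y:X s ` A|lebesgue. g s y) has_vector_derivative
      (LINT y:X t ` A|lebesgue. dt g t y + advect (w t y) (g t) y + dvg (w t) y *\<^sub>R g t y)) (at t)"
proof -
  let ?Z = "{(s, y). s \<in> I \<and> y \<in> D s}"
  have I: "open I" and \<Omega>: "open \<Omega>" and X: "Ck_on 1 (\<lambda>(s, x). X s x) (I \<times> \<Omega>)"
    and inj: "\<And>s. s \<in> I \<Longrightarrow> inj_on (X s) \<Omega>"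
    and XD: "\<And>s x. s \<in> I \<Longrightarrow> x \<in> \<Omega> \<Longrightarrow> X s x \<in> D s"
    and ode: "\<And>s x. s \<in> I \<Longrightarrow> x \<in> \<Omega> \<Longrightarrow> ((\<lambda>s. X s x) has_vector_derivative w s (X s x)) (at s)"
    using motion unfolding motion_on_def by (auto simp: image_subset_iff)
  define X' where "X' s x h = frechet_derivative (\<lambda>(s, x). X s x) (at (s, x)) (0, h)" for s x h
  define Dw where "Dw s y = frechet_derivative (\<lambda>(s, y). w s y) (at (s, y))" for s y
  define Dg where "Dg s y = frechet_derivative (\<lambda>(s, y). g s y) (at (s, y))" for s y
  define M where "M s x = matrix (X' s x)" for s x
  \<comment> \<open>This is the divergence of \<open>w s\<close>, written through the space-time
    derivative so that continuity along the motion follows from that of \<open>Dw\<close>.\<close>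
  define b where "b s y = trace (matrix (\<lambda>h. Dw s y (0, h)))" for s y
  have X': "(X s has_derivative X' s x) (at x)" if "s \<in> I" "x \<in> \<Omega>" for s x
    unfolding X'_def by (rule has_derivative_snd_arg[OF Ck_on_1_D(1)[OF X]]) (use that in auto)
  have Dw: "((\<lambda>(s, y). w s y) has_derivative Dw s y) (at (s, y))" if "s \<in> I" "y \<in> D s" for s y
    unfolding Dw_def by (rule Ck_on_1_D(1)[OF w]) (use that in auto)
  have Dg: "((\<lambda>(s, y). g s y) has_derivative Dg s y) (at (s, y))" if "s \<in> I" "y \<in> D s" for s y
    unfolding Dg_def by (rule Ck_on_1_D(1)[OF g]) (use that in auto)
  have contX: "continuous_on (I \<times> \<Omega>) (\<lambda>z. X (fst z) (snd z))"
    using Ck_on_1_D(3)[OF X] by (simp add: case_prod_unfold)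
  have contX': "continuous_on (I \<times> \<Omega>) (\<lambda>z. X' (fst z) (snd z) h)" for h
    unfolding X'_def by (rule Ck_on_1_continuous[OF X]) (auto intro!: continuous_intros)
  have contD: "continuous_on (I \<times> \<Omega>) (\<lambda>z. Dw (fst z) (X (fst z) (snd z)) (k z))"
    "continuous_on (I \<times> \<Omega>) (\<lambda>z. Dg (fst z) (X (fst z) (snd z)) (k z))"
    if "continuous_on (I \<times> \<Omega>) k" for k
    unfolding Dw_def Dg_def
    by (rule Ck_on_1_continuous[OF w] Ck_on_1_continuous[OF g];
        use that in \<open>auto intro!: continuous_intros contX XD\<close>)+
  have cont_wg: "continuous_on (I \<times> \<Omega>) (\<lambda>z. w (fst z) (X (fst z) (snd z)))"
    "continuous_on (I \<times> \<Omega>) (\<lambda>z. g (fst z) (X (fst z) (snd z)))"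
  proof -
    have "continuous_on (I \<times> \<Omega>) (\<lambda>z. (fst z, X (fst z) (snd z)))"
      by (intro continuous_intros contX)
    moreover have "(\<lambda>z. (fst z, X (fst z) (snd z))) ` (I \<times> \<Omega>) \<subseteq> ?Z"
      using XD by auto
    ultimately show "continuous_on (I \<times> \<Omega>) (\<lambda>z. w (fst z) (X (fst z) (snd z)))"
      "continuous_on (I \<times> \<Omega>) (\<lambda>z. g (fst z) (X (fst z) (snd z)))"
      using continuous_on_compose2[OF Ck_on_1_D(3)[OF w]] continuous_on_compose2[OF Ck_on_1_D(3)[OF g]]
      by fastforce+
  qed
  \<comment> \<open>The motion is only continuously differentiable, so even the existence of this
    time derivative has to be proved. The differential equation turns the time derivative of
    \<open>X\<close> into \<open>w\<close> evaluated along \<open>X\<close>, which can be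
    differentiated in space, and \<open>mixed_partials\<close> exchanges the order.\<close>
  have variational: "((\<lambda>s. X' s x h) has_vector_derivative Dw s (X s x) (0, X' s x h)) (at s)"
    if s: "s \<in> I" and x: "x \<in> \<Omega>" for s x h
  proof -
    have "open ((\<lambda>\<theta>. x + \<theta> *\<^sub>R h) -` \<Omega>)" (is "open ?O")
      by (intro open_vimage \<Omega> continuous_intros)
    moreover have "0 \<in> ?O" using x by simp
    ultimately obtain d1 d2 where d: "d1 > 0" "ball s d1 \<subseteq> I" "d2 > 0" "ball 0 d2 \<subseteq> ?O"
      using I s openE by metis
    have in_I: "\<sigma> \<in> I" if "\<bar>\<sigma> - s\<bar> < min d1 d2" for \<sigma>
      using that d(2) by (auto simp: dist_real_def subset_eq abs_minus_commute)
    have in_\<Omega>: "x + \<theta> *\<^sub>R h \<in> \<Omega>" if "\<bar>\<theta>\<bar> < min d1 d2" for \<theta>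
      using that d(4) by (auto simp: dist_real_def subset_eq)
    let ?\<Gamma> = "\<lambda>s \<theta>. Dw s (X s (x + \<theta> *\<^sub>R h)) (0, X' s (x + \<theta> *\<^sub>R h) h)"
    have line: "((\<lambda>\<theta>. x + \<theta> *\<^sub>R h) has_vector_derivative h) (at \<theta>)" for \<theta>
      by (auto intro!: derivative_eq_intros)
    have "((\<lambda>s. X' s x h) has_vector_derivative ?\<Gamma> s 0) (at s)"
    proof (rule mixed_partials[where \<delta> = "min d1 d2" and \<Phi> = "\<lambda>s \<theta>. X s (x + \<theta> *\<^sub>R h)"
        and \<Psi> = "\<lambda>s \<theta>. w s (X s (x + \<theta> *\<^sub>R h))" and \<Gamma> = ?\<Gamma>])
      have "continuous_on (I \<times> ?O) (\<lambda>z. Dw (fst z) (X (fst z) (x + snd z *\<^sub>R h)) (0, X' (fst z) (x + snd z *\<^sub>R h) h))"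
      proof -
        have "continuous_on (I \<times> \<Omega>) (\<lambda>z. Dw (fst z) (X (fst z) (snd z)) (0, X' (fst z) (snd z) h))"
          by (intro contD continuous_intros contX')
        moreover have "continuous_on (I \<times> ?O) (\<lambda>z. (fst z, x + snd z *\<^sub>R h))"
          by (intro continuous_intros)
        moreover have "(\<lambda>z. (fst z, x + snd z *\<^sub>R h)) ` (I \<times> ?O) \<subseteq> I \<times> \<Omega>" by auto
        ultimately show ?thesis using continuous_on_compose2 by fastforce
      qed
      then show "isCont (\<lambda>(s, \<theta>). ?\<Gamma> s \<theta>) (s, 0)"
        using s x I \<open>open ?O\<close>
        by (subst (asm) continuous_on_eq_continuous_at) (auto simp: case_prod_unfold open_Times)
    next
      fix \<sigma> \<theta> assume st: "\<bar>\<sigma> - s\<bar> < min d1 d2" "\<bar>\<theta>\<bar> < min d1 d2"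
      show "((\<lambda>s. X s (x + \<theta> *\<^sub>R h)) has_vector_derivative w \<sigma> (X \<sigma> (x + \<theta> *\<^sub>R h))) (at \<sigma>)"
        using st by (intro ode in_I in_\<Omega>)
      have "(X \<sigma> has_derivative X' \<sigma> (x + \<theta> *\<^sub>R h)) (at (x + \<theta> *\<^sub>R h))"
        using st by (intro X' in_I in_\<Omega>)
      from vector_derivative_diff_chain_within[OF line this[THEN has_derivative_at_withinI]]
      have "((\<lambda>\<theta>. X \<sigma> (x + \<theta> *\<^sub>R h)) has_vector_derivative X' \<sigma> (x + \<theta> *\<^sub>R h) h) (at \<theta>)"
        by (simp add: o_def)
      moreover have "(w \<sigma> has_derivative (\<lambda>k. Dw \<sigma> (X \<sigma> (x + \<theta> *\<^sub>R h)) (0, k))) (at (X \<sigma> (x + \<theta> *\<^sub>R h)))"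
        using st by (intro has_derivative_snd_arg Dw XD in_I in_\<Omega>)
      ultimately show "((\<lambda>\<theta>. w \<sigma> (X \<sigma> (x + \<theta> *\<^sub>R h))) has_vector_derivative ?\<Gamma> \<sigma> \<theta>) (at \<theta>)"
        using vector_derivative_diff_chain_within[OF _ has_derivative_at_withinI] by (fastforce simp: o_def)
    next
      fix \<sigma> assume "\<bar>\<sigma> - s\<bar> < min d1 d2"
      then have "(X \<sigma> has_derivative X' \<sigma> x) (at (x + 0 *\<^sub>R h))"
        using x by (simp add: X' in_I)
      from vector_derivative_diff_chain_within[OF line this[THEN has_derivative_at_withinI]]
      show "((\<lambda>\<theta>. X \<sigma> (x + \<theta> *\<^sub>R h)) has_vector_derivative X' \<sigma> x h) (at 0)"
        by (simp add: o_def)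
    qed (use d in auto)
    then show ?thesis by simp
  qed
  have absdet: "((\<lambda>s. \<bar>det (M s x)\<bar>) has_field_derivative b s (X s x) * \<bar>det (M s x)\<bar>) (at s)"
    if s: "s \<in> I" and x: "x \<in> \<Omega>" for s x
    unfolding b_def
  proof (rule abs_has_field_derivative_linear, rule det_has_field_derivative_3)
    fix i j :: 3
    have "linear (X' s x)"
      using X'[OF s x] by (rule has_derivative_linear)
    moreover have "linear (\<lambda>h. Dw s (X s x) (0, h))"
      using has_derivative_snd_arg[OF Dw[OF s XD[OF s x]]] by (rule has_derivative_linear)
    \<comment> \<open>Read column by column, the variational equation says that \<open>M\<close>
      solves a linear matrix equation whose coefficient is the spatial Jacobian of \<open>w\<close>,
      as Jacobi's formula requires.\<close>
    ultimately have "matrix (\<lambda>h. Dw s (X s x) (0, h)) ** M s x = matrix (\<lambda>h. Dw s (X s x) (0, X' s x h))"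
      unfolding M_def by (subst matrix_compose[symmetric]) (auto simp: o_def)
    then have "(matrix (\<lambda>h. Dw s (X s x) (0, h)) ** M s x) $ i $ j = Dw s (X s x) (0, X' s x (axis j 1)) $ i"
      by (simp add: matrix_def)
    moreover have "((\<lambda>s. X' s x (axis j 1) $ i) has_vector_derivative Dw s (X s x) (0, X' s x (axis j 1)) $ i) (at s)"
      using bounded_linear.has_vector_derivative[OF bounded_linear_vec_nth variational[OF s x]] .
    ultimately show "((\<lambda>s. M s x $ i $ j) has_real_derivative (matrix (\<lambda>h. Dw s (X s x) (0, h)) ** M s x) $ i $ j) (at s)"
      by (simp add: M_def matrix_def has_real_derivative_iff_has_vector_derivative)
  qed
  define \<phi> where "\<phi> s x = \<bar>det (M s x)\<bar> *\<^sub>R g s (X s x)" for s x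
  \<comment> \<open>The sum of the material derivative of \<open>g\<close> and the dilation
    term.\<close>
  define G where "G s y = Dg s y (1, w s y) + b s y *\<^sub>R g s y" for s y
  define \<phi>' where "\<phi>' s x = \<bar>det (M s x)\<bar> *\<^sub>R G s (X s x)" for s x
  have contM: "continuous_on (I \<times> \<Omega>) (\<lambda>z. \<bar>det (M (fst z) (snd z))\<bar>)"
    unfolding det_3 M_def matrix_def by (auto intro!: continuous_intros contX')
  have cont: "continuous_on (I \<times> \<Omega>) (\<lambda>z. \<phi> (fst z) (snd z))"
    unfolding \<phi>_def by (intro continuous_on_scaleR contM cont_wg)
  have cont': "continuous_on (I \<times> \<Omega>) (\<lambda>z. \<phi>' (fst z) (snd z))"
    unfolding \<phi>'_def G_def b_def trace_def matrix_def
    by (auto intro!: continuous_on_scaleR continuous_on_add contM cont_wg contD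
        continuous_on_Pair continuous_on_const continuous_on_sum continuous_on_component)
  have d\<phi>: "((\<lambda>s. \<phi> s x) has_vector_derivative \<phi>' s x) (at s)" if s: "s \<in> I" and x: "x \<in> \<Omega>" for s x
  proof -
    have "((\<lambda>s. g s (X s x)) has_vector_derivative Dg s (X s x) (1, w s (X s x))) (at s)"
      by (rule has_vector_derivative_along_curve[OF Dg ode]) (use s x XD in auto)
    from has_vector_derivative_scaleR[OF absdet[OF s x] this] show ?thesis
      unfolding \<phi>_def \<phi>'_def G_def by (simp add: algebra_simps)
  qed
  have comp: "compact (closure A)" "A \<subseteq> closure A"
    using A closure_subset by (auto simp: compact_closure)
  have slice: "continuous_on (closure A) (\<lambda>x. f s x)" if "continuous_on (I \<times> \<Omega>) (\<lambda>z. f (fst z) (snd z))" "s \<in> I"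
    for f :: "real \<Rightarrow> space \<Rightarrow> space" and s
  proof -
    have "continuous_on (closure A) (\<lambda>x. f (fst (s, x)) (snd (s, x)))"
      by (rule continuous_on_compose2[OF that(1)]) (use that(2) A in \<open>auto intro!: continuous_intros\<close>)
    then show ?thesis by simp
  qed
  have cov: "(LINT y:X s ` A|lebesgue. f s y) = (LINT x:A|lebesgue. \<bar>det (M s x)\<bar> *\<^sub>R f s (X s x))"
    if "continuous_on (I \<times> \<Omega>) (\<lambda>z. \<bar>det (M (fst z) (snd z))\<bar> *\<^sub>R f (fst z) (X (fst z) (snd z)))" "s \<in> I"
    for f :: "real \<Rightarrow> space \<Rightarrow> space" and s
    unfolding M_def
  proof (rule set_lebesgue_integral_image[OF A(1)])
    show "set_integrable lebesgue A (\<lambda>x. \<bar>det (matrix (X' s x))\<bar> *\<^sub>R f s (X s x))"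
      using slice[of "\<lambda>s x. \<bar>det (M s x)\<bar> *\<^sub>R f s (X s x)" s] that
      by (intro set_integrable_continuous_compact[OF A(1) comp]) (auto simp: M_def)
    show "inj_on (X s) A"
      using inj[OF that(2)] comp(2) A(3) by (meson inj_on_subset order_trans)
  qed (use X' that(2) comp(2) A(3) in blast)
  have "((\<lambda>s. LINT x:A|lebesgue. \<phi> s x) has_vector_derivative (LINT x:A|lebesgue. \<phi>' t x)) (at t)"
  proof (rule has_vector_derivative_set_lebesgue_integral[OF A(1) comp I t])
    show "continuous_on (I \<times> closure A) (\<lambda>(s, x). \<phi>' s x)"
      using continuous_on_subset[OF cont'] A(3) by (simp add: case_prod_unfold Sigma_mono)
  qed (use slice cont d\<phi> A(3) in auto)
  then have "((\<lambda>s. LINT y:X s ` A|lebesgue. g s y) has_vector_derivative (LINT x:A|lebesgue. \<phi>' t x)) (at t)"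
    by (rule has_vector_derivative_transform_within_open[OF _ I t])
      (use cov[of g] cont in \<open>simp add: \<phi>_def\<close>)
  moreover have "(LINT x:A|lebesgue. \<phi>' t x) = (LINT y:X t ` A|lebesgue. G t y)"
    using cov[of G t] cont' t by (simp add: \<phi>'_def)
  also have "\<dots> = (LINT y:X t ` A|lebesgue. dt g t y + advect (w t y) (g t) y + dvg (w t) y *\<^sub>R g t y)"
    unfolding set_lebesgue_integral_def
  proof (intro Bochner_Integration.integral_cong refl)
    fix y
    \<comment> \<open>The operators on the right are tied to total derivatives only where the fields
      are known to be differentiable; the carried region lies inside \<open>D t\<close>, so this
      suffices.\<close>
    have "G t y = dt g t y + advect (w t y) (g t) y + dvg (w t) y *\<^sub>R g t y" if "y \<in> D t"
    proof -
      note Dg = Dg[OF t that] and Dw = Dw[OF t that]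
      have "Dg t y (1, w t y) = Dg t y (1, 0) + Dg t y (0, w t y)"
        using linear_add[OF has_derivative_linear[OF Dg], of "(1, 0)" "(0, w t y)"] by simp
      then show ?thesis
        by (simp add: G_def b_def trace_def matrix_def dt_eq[OF Dg] advect_eq[OF has_derivative_snd_arg[OF Dg]]
            dvg_eq[OF has_derivative_snd_arg[OF Dw]])
    qed
    moreover have "X t ` A \<subseteq> D t"
      using XD[OF t] comp(2) A(3) by blast
    ultimately show "indicator (X t ` A) y *\<^sub>R G t y =
        indicator (X t ` A) y *\<^sub>R (dt g t y + advect (w t y) (g t) y + dvg (w t) y *\<^sub>R g t y)"
      by (auto simp: indicator_def)
  qed
  finally show ?thesis by simp
qed

section \<open>Vector calculus\<close>

lemma grad_eqI:
  assumes "GDERIV f x :> D"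
  shows "grad f x = D"
  unfolding grad_def
proof (rule the_equality)
  show "GDERIV f x :> D" by (rule assms)
next
  fix D' assume "GDERIV f x :> D'"
  then have "(\<lambda>h. h \<bullet> D') = (\<lambda>h. h \<bullet> D)"
    using assms unfolding gderiv_def by (rule has_derivative_unique)
  then show "D' = D"
    by (simp add: fun_eq_iff vector_eq_ldot)
qed

text \<open>Since \<open>grad\<close> is a definite description, a vector satisfying
  \<open>GDERIV\<close> must first be produced: \<open>adjoint f' 1\<close> represents the
  functional \<open>f'\<close>.\<close>

lemma grad_inner:
  assumes "(f has_derivative f') (at x)"
  shows "grad f x \<bullet> h = f' h"
proof -
  have "f' = (\<lambda>h. h \<bullet> adjoint f' 1)"
    using adjoint_works[OF has_derivative_linear[OF assms], of _ 1] by (simp add: fun_eq_iff)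
  then have "GDERIV f x :> adjoint f' 1"
    using assms by (simp add: gderiv_def)
  then have "grad f x = adjoint f' 1" by (rule grad_eqI)
  with \<open>f' = _\<close> show ?thesis by (metis inner_commute)
qed

lemma has_derivative_grad_inner:
  assumes "f differentiable at x"
  shows "(f has_derivative (\<lambda>h. grad f x \<bullet> h)) (at x)"
  using assms grad_inner frechet_derivative_works by (metis (no_types, lifting) ext)

lemma grad_add:
  assumes "f differentiable at x" "g differentiable at x"
  shows "grad (\<lambda>y. f y + g y) x = grad f x + grad g x"
  using has_derivative_add[OF assms[THEN has_derivative_grad_inner]]
  by (intro grad_eqI) (simp add: gderiv_def inner_commute inner_add_left inner_add_right)

text \<open>Serves at the zeros of the nonnegative density, which are global minima.\<close>

lemma grad_zero_at_min:
  assumes "f differentiable at x" "\<And>y. f x \<le> f y"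
  shows "grad f x = 0"
proof -
  have "(\<lambda>h. grad f x \<bullet> h) = (\<lambda>h. 0)"
    by (rule differential_zero_maxmin[of x UNIV f])
      (use has_derivative_grad_inner[OF assms(1)] assms(2) in auto)
  then show ?thesis by (metis inner_eq_zero_iff)
qed

lemma dvg_scaleR:
  assumes "r differentiable at x" "(F has_derivative F') (at x)"
  shows "dvg (\<lambda>y. r y *\<^sub>R F y) x = grad r x \<bullet> F x + r x * dvg F x"
proof -
  have "grad r x \<bullet> axis i 1 = grad r x $ i" for i
    by (simp add: inner_axis)
  then show ?thesis
    by (simp add: dvg_eq[OF has_derivative_scaleR[OF has_derivative_grad_inner[OF assms(1)] assms(2)]]
        dvg_eq[OF assms(2)] inner_vec_def sum.distrib sum_distrib_left)
qed

lemma dvg_const_scaleR: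
  assumes "F differentiable at x"
  shows "dvg (\<lambda>y. c *\<^sub>R F y) x = c * dvg F x"
proof -
  obtain F' where F': "(F has_derivative F') (at x)"
    using assms by (auto simp: differentiable_def)
  show ?thesis
    by (simp add: dvg_eq[OF has_derivative_scaleR_right[OF F']] dvg_eq[OF F'] sum_distrib_left)
qed

lemma has_vector_derivative_dt:
  assumes "Ck_on 1 (\<lambda>(t, x). f t x) UNIV"
  shows "((\<lambda>\<tau>. f \<tau> x) has_vector_derivative dt f t x) (at t)"
  using has_vector_derivative_along_curve[of f _ t "\<lambda>_. x", OF Ck_on_1_D(1)[OF assms UNIV_I] has_vector_derivative_const]
    dt_eq[OF Ck_on_1_D(1)[OF assms UNIV_I]]
  by simp

text \<open>The map \<open>H\<close> is the Hessian, and its symmetry is that of second derivatives.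
  The gradient is rebuilt from its basis components because \<open>Ck_on\<close> speaks of fixed
  directions only.\<close>

lemma grad_Ck_on_2:
  assumes "Ck_on 2 f UNIV"
  obtains H where "(grad f has_derivative H) (at x)" "\<And>h k. H h \<bullet> k = H k \<bullet> h"
proof -
  have f: "f differentiable at y" "(\<lambda>y. frechet_derivative f (at y) h) differentiable at y" for y h
    using assms by (auto simp: numeral_2_eq_2)
  have D: "frechet_derivative f (at y) h = grad f y \<bullet> h" for y h
    using frechet_derivative_at[OF has_derivative_grad_inner[OF f(1)]] by metis
  have "grad f = (\<lambda>y. \<Sum>b\<in>Basis. frechet_derivative f (at y) b *\<^sub>R b)"
    by (simp add: D euclidean_representation)
  moreover have "(\<lambda>y. \<Sum>b\<in>Basis. frechet_derivative f (at y) b *\<^sub>R b) differentiable at x"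
    by (intro differentiable_sum ballI differentiable_scaleR f) auto
  ultimately obtain H where H: "(grad f has_derivative H) (at x)"
    by (auto simp: differentiable_def)
  have "frechet_derivative (\<lambda>y. frechet_derivative f (at y) k) (at x) h = H h \<bullet> k" for h k
    unfolding D using frechet_derivative_at[OF has_derivative_inner_left[OF H, of k]] by metis
  then have "H h \<bullet> k = H k \<bullet> h" for h k
    using frechet_derivative_symmetric[OF assms, of k x h] by simp
  then show thesis using H that by blast
qed

text \<open>The Laplacian is a finite sum of iterated directional derivatives, each differentiable
  by third-order regularity. This makes \<open>P\<close> and the divergence of \<open>v\<close>
  differentiable, so that gradients of sums can be split.\<close>

lemma dvg_grad_differentiable:
  assumes "Ck_on 3 f UNIV"
  shows "(\<lambda>y. dvg (grad f) y) differentiable at x"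
proof -
  let ?D = "\<lambda>h y. frechet_derivative f (at y) h"
  have f: "f differentiable at y" "?D h differentiable at y"
    "(\<lambda>y. frechet_derivative (?D h) (at y) k) differentiable at y" for y h k
    using assms by (auto simp: numeral_3_eq_3)
  have f2: "Ck_on 2 f UNIV"
    using assms by (rule Ck_on_3_imp_2)
  have "dvg (grad f) y = (\<Sum>i\<in>UNIV. frechet_derivative (?D (axis i 1)) (at y) (axis i 1))" for y
  proof -
    obtain H where H: "(grad f has_derivative H) (at y)"
      using grad_Ck_on_2[OF f2] by metis
    have "?D h = (\<lambda>y. grad f y \<bullet> h)" for h
      using frechet_derivative_at[OF has_derivative_grad_inner[OF f(1)]] by metis
    then have "frechet_derivative (?D h) (at y) k = H k \<bullet> h" for h k
      using frechet_derivative_at[OF has_derivative_inner_left[OF H, of h]] by metis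
    then show ?thesis by (simp add: dvg_eq[OF H] inner_axis)
  qed
  then show ?thesis
    by (simp add: f differentiable_sum)
qed

text \<open>Reconciles two groupings of the product rule: the integrand of Reynolds' theorem for the
  momentum density, and the one in which advection acts on the velocity alone.\<close>

lemma transport_rate_eq:
  assumes "r t differentiable at x" "(w t has_derivative w') (at x)"
  shows "transport_rate r w t x = dt (\<lambda>\<tau> y. r \<tau> y *\<^sub>R w \<tau> y) t x
    + advect (w t x) (\<lambda>y. r t y *\<^sub>R w t y) x + dvg (w t) x *\<^sub>R (r t x *\<^sub>R w t x)"
  unfolding transport_rate_def dvg_scaleR[OF assms] advect_eq[OF assms(2)]
    advect_eq[OF has_derivative_scaleR[OF has_derivative_grad_inner[OF assms(1)] assms(2)]]
  by (simp add: algebra_simps)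

text \<open>
  No measurability is needed: by completeness \<open>f\<close> and \<open>g\<close> are measurable together, and otherwise
  both integrals have the junk value \<open>0\<close>.
\<close>

lemma set_lebesgue_integral_cong_AE_lebesgue:
  fixes f g :: "'a::euclidean_space \<Rightarrow> 'b::euclidean_space"
  assumes "AE x in lebesgue. f x = g x"
  shows "(LINT x:V|lebesgue. f x) = (LINT x:V|lebesgue. g x)"
proof -
  let ?f = "\<lambda>x. indicator V x *\<^sub>R f x" and ?g = "\<lambda>x. indicator V x *\<^sub>R g x"
  have ae: "AE x in lebesgue. ?f x = ?g x" "AE x in lebesgue. ?g x = ?f x"
    using assms by auto
  show ?thesis
  proof (cases "?f \<in> borel_measurable lebesgue")
    case True
    then show ?thesis
      unfolding set_lebesgue_integral_def
      by (intro integral_cong_AE ae borel_measurable_AE[OF True ae(1)])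
  next
    case False
    then have "?g \<notin> borel_measurable lebesgue"
      using borel_measurable_AE[OF _ ae(2)] by blast
    with False show ?thesis
      unfolding set_lebesgue_integral_def
      by (metis borel_measurable_integrable not_integrable_integral_eq)
  qed
qed

section \<open>The quantum flow\<close>

context
  fixes hbar m :: real and \<rho> S U :: scalar_field
  assumes hbar: "hbar > 0" and m: "m > 0"
    and nonneg: "\<And>t x. \<rho> t x \<ge> 0"
    and reg: "regular_flow \<rho> S"
begin

section \<open>Regularity of the density and of the two velocity fields\<close>

lemma smooth:
  "Ck_on 1 (\<lambda>(t, x). \<rho> t x) UNIV" "Ck_on 1 (\<lambda>(t, x). grad (\<rho> t) x) UNIV"
  "Ck_on 1 (\<lambda>(t, x). grad (S t) x) UNIV" "Ck_on 3 (\<rho> t) UNIV" "Ck_on 3 (S t) UNIV"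
  using reg by (auto simp: regular_flow_def)

lemma Ck_on_2_density: "Ck_on 2 (\<rho> t) UNIV" and Ck_on_2_phase: "Ck_on 2 (S t) UNIV"
  by (rule Ck_on_3_imp_2[OF smooth(4)], rule Ck_on_3_imp_2[OF smooth(5)])

lemma density_differentiable: "\<rho> t differentiable at x"
  using smooth(4)[of t] by (auto simp: numeral_3_eq_3)

text \<open>Valid on the zero set as well: division by zero makes the left side 0, and there the
  density is minimal, so its gradient vanishes. Thus the product of \<rho> and \<open>u\<close>
  inherits the smoothness of the gradient of \<rho>.\<close>

lemma density_scaleR_vel_u: "\<rho> t x *\<^sub>R vel_u hbar m \<rho> t x = - zeta hbar m *\<^sub>R grad (\<rho> t) x"
proof (cases "\<rho> t x = 0")
  case True
  then have "grad (\<rho> t) x = 0"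
    using grad_zero_at_min[OF density_differentiable] nonneg by metis
  with True show ?thesis by simp
qed (simp add: vel_u_def)

lemma zeta_pos: "zeta hbar m > 0" and zeta0_eq: "zeta0 hbar = m * zeta hbar m"
  using hbar m by (auto simp: zeta_def zeta0_def)

lemma vel_v_deriv:
  obtains v' where "(vel_v m S t has_derivative v') (at x)" "\<And>h k. v' h \<bullet> k = v' k \<bullet> h"
proof -
  obtain K where K: "(grad (S t) has_derivative K) (at x)" "\<And>h k. K h \<bullet> k = K k \<bullet> h"
    using grad_Ck_on_2[OF Ck_on_2_phase[of t]] by metis
  show thesis
  proof (rule that)
    show "(vel_v m S t has_derivative (\<lambda>h. (1 / m) *\<^sub>R K h)) (at x)"
      unfolding vel_v_def by (rule has_derivative_scaleR_right[OF K(1)])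
  qed (use K(2) in simp)
qed

text \<open>Up to a constant, \<open>u\<close> is the gradient of the logarithm of \<rho>. Its
  Jacobian combines the Hessian of \<rho> with a rank-one term built from the gradient twice, and
  both are symmetric.\<close>

lemma vel_u_deriv:
  assumes "\<rho> t x > 0"
  obtains u' where "(vel_u hbar m \<rho> t has_derivative u') (at x)" "\<And>h k. u' h \<bullet> k = u' k \<bullet> h"
proof -
  obtain H where H: "(grad (\<rho> t) has_derivative H) (at x)" "\<And>h k. H h \<bullet> k = H k \<bullet> h"
    using grad_Ck_on_2[OF Ck_on_2_density[of t]] by metis
  note R = has_derivative_grad_inner[OF density_differentiable[of t x]]
  show thesis
  proof (rule that)
    show "(vel_u hbar m \<rho> t has_derivative (\<lambda>h. - zeta hbar m *\<^sub>R (inverse (\<rho> t x) *\<^sub>R H h +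
        (- (inverse (\<rho> t x) * (grad (\<rho> t) x \<bullet> h) * inverse (\<rho> t x))) *\<^sub>R grad (\<rho> t) x))) (at x)"
      unfolding vel_u_def
      by (intro has_derivative_scaleR_right has_derivative_scaleR Deriv.has_derivative_inverse R H)
        (use assms in simp)
  qed (simp add: algebra_simps inner_commute, metis H(2) inner_commute)
qed

lemma transport_rate_eq_momentum_source:
  assumes pos: "\<rho> t x > 0"
    and continuity: "dt \<rho> t x + dvg (\<lambda>y. \<rho> t y *\<^sub>R vel_v m S t y) x = 0"
    and euler: "dt (\<lambda>\<tau> y. mass_density m \<rho> \<tau> y *\<^sub>R vel_u hbar m \<rho> \<tau> y) t x
       + mass_density m \<rho> t x *\<^sub>R dt (vel_v m S) t x
       + (1 / 2 * mass_density m \<rho> t x) *\<^sub>R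
           grad (\<lambda>y. (norm (vel_u hbar m \<rho> t y))\<^sup>2 + (norm (vel_v m S t y))\<^sup>2) x
       + grad (\<lambda>y. P_u hbar m \<rho> t y + p_v hbar m \<rho> S t y) x
       + dvg (\<lambda>y. mass_density m \<rho> t y *\<^sub>R vel_u hbar m \<rho> t y) x *\<^sub>R vel_u hbar m \<rho> t x
       + \<rho> t x *\<^sub>R grad (U t) x = 0"
  shows "transport_rate (mass_density m \<rho>) (vel_w hbar m \<rho> S) t x = momentum_source hbar m \<rho> S U t x"
proof -
  define \<zeta> where "\<zeta> = zeta hbar m"
  define u where "u = vel_u hbar m \<rho>"
  define v where "v = vel_v m S"
  define P where "P = P_u hbar m \<rho> t"
  define p where "p = p_v hbar m \<rho> S t"
  define Du where "Du = dvg (\<lambda>y. \<rho> t y *\<^sub>R u t y) x"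
  define Dv where "Dv = dvg (\<lambda>y. \<rho> t y *\<^sub>R v t y) x"
  define G where "G = grad (\<rho> t)"
  have \<zeta>: "\<zeta> > 0" "zeta0 hbar = m * \<zeta>"
    using zeta_pos zeta0_eq by (simp_all add: \<zeta>_def)
  obtain u' where u': "(u t has_derivative u') (at x)" and u'_sym: "\<And>h k. u' h \<bullet> k = u' k \<bullet> h"
    using vel_u_deriv[of t x] pos unfolding u_def by metis
  obtain v' where v': "(v t has_derivative v') (at x)" and v'_sym: "\<And>h k. v' h \<bullet> k = v' k \<bullet> h"
    using vel_v_deriv[of t x] unfolding v_def by metis
  obtain H where H: "(G has_derivative H) (at x)"
    using grad_Ck_on_2[OF Ck_on_2_density[of t]] unfolding G_def by metis
  have v_diff: "v t differentiable at y" for y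
    using vel_v_deriv[of t y] unfolding v_def differentiable_def by metis
  have G_diff: "G differentiable at y" for y
    using grad_Ck_on_2[OF Ck_on_2_density[of t]] unfolding G_def differentiable_def by metis
  have R: "(\<rho> t has_derivative (\<lambda>h. G y \<bullet> h)) (at y)" for y
    unfolding G_def by (rule has_derivative_grad_inner[OF density_differentiable])
  have \<rho>u: "\<rho> t y *\<^sub>R u t y = - \<zeta> *\<^sub>R G y" for y
    using density_scaleR_vel_u[of t y] by (simp add: u_def \<zeta>_def G_def)
  have w: "vel_w hbar m \<rho> S = (\<lambda>t x. u t x + v t x)"
    by (simp add: fun_eq_iff vel_w_def u_def v_def)
  have \<rho>m: "mass_density m \<rho> = (\<lambda>t x. m * \<rho> t x)"
    by (simp add: fun_eq_iff mass_density_def)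

  have dt_v: "((\<lambda>\<tau>. v \<tau> x) has_vector_derivative dt v t x) (at t)"
  proof -
    have "((\<lambda>\<tau>. v \<tau> x) has_vector_derivative (1 / m) *\<^sub>R dt (\<lambda>t. grad (S t)) t x) (at t)"
      unfolding v_def vel_v_def
      by (rule bounded_linear.has_vector_derivative[OF bounded_linear_scaleR_right has_vector_derivative_dt[OF smooth(3)]])
    then show ?thesis by (simp add: dt_def vector_derivative_at)
  qed
  have dt_\<rho>u: "((\<lambda>\<tau>. (m * \<rho> \<tau> x) *\<^sub>R u \<tau> x) has_vector_derivative dt (\<lambda>\<tau> y. (m * \<rho> \<tau> y) *\<^sub>R u \<tau> y) t x) (at t)"
  proof -
    \<comment> \<open>Writing the momentum of \<open>u\<close> as a multiple of the gradient of
      \<rho> avoids differentiating the quotient in \<open>u\<close>.\<close>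
    have "(\<lambda>\<tau>. (m * \<rho> \<tau> x) *\<^sub>R u \<tau> x) = (\<lambda>\<tau>. (- m * \<zeta>) *\<^sub>R grad (\<rho> \<tau>) x)"
      using density_scaleR_vel_u[of _ x]
      by (simp add: u_def \<zeta>_def scaleR_scaleR[symmetric] del: scaleR_scaleR)
    moreover have "((\<lambda>\<tau>. (- m * \<zeta>) *\<^sub>R grad (\<rho> \<tau>) x) has_vector_derivative
        (- m * \<zeta>) *\<^sub>R dt (\<lambda>t. grad (\<rho> t)) t x) (at t)"
      by (rule bounded_linear.has_vector_derivative[OF bounded_linear_scaleR_right has_vector_derivative_dt[OF smooth(2)]])
    ultimately show ?thesis by (simp add: dt_def vector_derivative_at)
  qed
  have dt_\<rho>: "((\<lambda>\<tau>. m * \<rho> \<tau> x) has_real_derivative m * dt \<rho> t x) (at t)"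
    using has_vector_derivative_dt[OF smooth(1), of x t]
    by (auto simp: has_real_derivative_iff_has_vector_derivative[symmetric] intro: DERIV_cmult)
  \<comment> \<open>The \<open>u\<close> part stays whole because the Euler equation contains it in
    this form; the \<open>v\<close> part is split so that the time derivative of \<rho> can be
    replaced through the continuity equation.\<close>
  have dt_w: "dt (\<lambda>\<tau> y. mass_density m \<rho> \<tau> y *\<^sub>R vel_w hbar m \<rho> S \<tau> y) t x =
      dt (\<lambda>\<tau> y. (m * \<rho> \<tau> y) *\<^sub>R u \<tau> y) t x + (m * \<rho> t x) *\<^sub>R dt v t x + (m * dt \<rho> t x) *\<^sub>R v t x"
    using has_vector_derivative_add[OF dt_\<rho>u has_vector_derivative_scaleR[OF dt_\<rho> dt_v]]
    unfolding w \<rho>m by (subst dt_def) (simp add: scaleR_add_right add.assoc vector_derivative_at)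

  have P_eq: "P = (\<lambda>y. (- m * \<zeta> * \<zeta>) * dvg G y)"
  proof
    fix y
    have "dvg (\<lambda>y. \<rho> t y *\<^sub>R u t y) y = - \<zeta> * dvg G y"
      unfolding \<rho>u by (rule dvg_const_scaleR[OF G_diff])
    then show "P y = (- m * \<zeta> * \<zeta>) * dvg G y"
      by (simp add: P_def P_u_def u_def[symmetric] \<zeta>(2))
  qed
  have P_diff: "P differentiable at x"
    unfolding P_eq G_def by (intro differentiable_mult differentiable_const dvg_grad_differentiable smooth)
  have p_eq: "p = (\<lambda>y. - (m * \<zeta>) * (G y \<bullet> v t y + \<rho> t y * dvg (v t) y))"
  proof
    fix y
    obtain F' where "(v t has_derivative F') (at y)"
      using v_diff[of y] by (auto simp: differentiable_def)
    then show "p y = - (m * \<zeta>) * (G y \<bullet> v t y + \<rho> t y * dvg (v t) y)"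
      by (simp add: p_def p_v_def v_def[symmetric] \<zeta>(2) G_def dvg_scaleR[OF density_differentiable])
  qed
  have dvg_v_diff: "dvg (v t) differentiable at x"
  proof -
    have "dvg (v t) = (\<lambda>y. (1 / m) * dvg (grad (S t)) y)"
      using grad_Ck_on_2[OF Ck_on_2_phase[of t]] dvg_const_scaleR[of "grad (S t)"]
      unfolding v_def vel_v_def differentiable_def fun_eq_iff by metis
    then show ?thesis
      by (simp only:) (intro differentiable_mult differentiable_const dvg_grad_differentiable smooth)
  qed
  have \<eta>_diff: "(\<lambda>y. (m * \<zeta> * \<rho> t y) * dvg (v t) y) differentiable at x"
    by (intro differentiable_mult differentiable_const dvg_v_diff density_differentiable)
  have Gv: "((\<lambda>y. G y \<bullet> v t y) has_derivative (\<lambda>h. G x \<bullet> v' h + H h \<bullet> v t x)) (at x)"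
    by (rule has_derivative_inner[OF H v'])
  \<comment> \<open>By \<open>\<zeta>(2)\<close> the factor \<open>m * \<zeta> * \<rho> t y\<close>
    is \<open>eta\<close>. Its product with the divergence of \<open>v\<close> is kept as one
    summand, since its gradient occurs unexpanded in the target.\<close>
  have p_eq': "p = (\<lambda>y. - (m * \<zeta>) * (G y \<bullet> v t y) + - ((m * \<zeta> * \<rho> t y) * dvg (v t) y))"
    unfolding p_eq by (simp add: algebra_simps)
  have p': "(p has_derivative (\<lambda>h. - (m * \<zeta>) * (G x \<bullet> v' h + H h \<bullet> v t x)
      + - (grad (\<lambda>y. (m * \<zeta> * \<rho> t y) * dvg (v t) y) x \<bullet> h))) (at x)"
    unfolding p_eq'
    by (intro has_derivative_add has_derivative_mult_right has_derivative_minus Gv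
        has_derivative_grad_inner[OF \<eta>_diff])
  have p_diff: "p differentiable at x"
    using p' by (auto simp: differentiable_def)
  \<comment> \<open>Differentiating \<open>\<rho>u\<close> in two ways expresses the Hessian of
    \<rho> through \<open>u\<close> and its Jacobian.\<close>
  have H_eq: "- \<zeta> *\<^sub>R H h = (G x \<bullet> h) *\<^sub>R u t x + \<rho> t x *\<^sub>R u' h" for h
  proof -
    have "((\<lambda>y. - \<zeta> *\<^sub>R G y) has_derivative (\<lambda>h. - \<zeta> *\<^sub>R H h)) (at x)"
      by (rule has_derivative_scaleR_right[OF H])
    moreover have "((\<lambda>y. - \<zeta> *\<^sub>R G y) has_derivative (\<lambda>h. \<rho> t x *\<^sub>R u' h + (G x \<bullet> h) *\<^sub>R u t x)) (at x)"
      using has_derivative_scaleR[OF R u'] by (simp add: \<rho>u)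
    ultimately have "(\<lambda>h. - \<zeta> *\<^sub>R H h) = (\<lambda>h. \<rho> t x *\<^sub>R u' h + (G x \<bullet> h) *\<^sub>R u t x)"
      by (rule has_derivative_unique)
    then show ?thesis by (simp add: fun_eq_iff add.commute)
  qed
  have N: "grad (\<lambda>y. (norm (u t y))\<^sup>2 + (norm (v t y))\<^sup>2) x \<bullet> h = 2 * (u t x \<bullet> u' h) + 2 * (v t x \<bullet> v' h)" for h
    unfolding power2_norm_eq_inner
    by (subst grad_inner[OF has_derivative_add[OF has_derivative_inner[OF u' u'] has_derivative_inner[OF v' v']]])
      (simp add: inner_commute)

  have uv_diff: "\<rho> t differentiable at x" "u t differentiable at x" "v t differentiable at x"
    using density_differentiable u' v' by (auto simp: differentiable_def)
  have \<rho>w: "dvg (\<lambda>y. \<rho> t y *\<^sub>R (u t y + v t y)) x = Du + Dv"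
    unfolding Du_def Dv_def
    using dvg_eq[OF has_derivative_add[OF has_derivative_scaleR[OF R[of x] u'] has_derivative_scaleR[OF R[of x] v']]]
      dvg_eq[OF has_derivative_scaleR[OF R[of x] u']] dvg_eq[OF has_derivative_scaleR[OF R[of x] v']]
    by (simp add: scaleR_add_right sum.distrib)
  have dvg_m: "dvg (\<lambda>y. (m * \<rho> t y) *\<^sub>R F y) x = m * dvg (\<lambda>y. \<rho> t y *\<^sub>R F y) x"
    if "F differentiable at x" for F
    using dvg_const_scaleR[of "\<lambda>y. \<rho> t y *\<^sub>R F y" x m] differentiable_scaleR[OF density_differentiable that]
    by simp
  have T: "transport_rate (mass_density m \<rho>) (vel_w hbar m \<rho> S) t x =
      dt (\<lambda>\<tau> y. (m * \<rho> \<tau> y) *\<^sub>R u \<tau> y) t x + (m * \<rho> t x) *\<^sub>R dt v t x + (m * dt \<rho> t x) *\<^sub>R v t x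
      + (m * \<rho> t x) *\<^sub>R (u' (u t x + v t x) + v' (u t x + v t x)) + (m * (Du + Dv)) *\<^sub>R (u t x + v t x)"
    unfolding transport_rate_def dt_w
    unfolding w \<rho>m advect_eq[OF has_derivative_add[OF u' v']]
    by (simp add: dvg_m[OF differentiable_add[OF uv_diff(2,3)]] \<rho>w)
  have E: "dt (\<lambda>\<tau> y. (m * \<rho> \<tau> y) *\<^sub>R u \<tau> y) t x + (m * \<rho> t x) *\<^sub>R dt v t x
      + (1 / 2 * (m * \<rho> t x)) *\<^sub>R grad (\<lambda>y. (norm (u t y))\<^sup>2 + (norm (v t y))\<^sup>2) x
      + (grad P x + grad p x) + (m * Du) *\<^sub>R u t x + \<rho> t x *\<^sub>R grad (U t) x = 0"
    using euler unfolding \<rho>m u_def[symmetric] v_def[symmetric] P_def[symmetric] p_def[symmetric]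
    by (simp add: grad_add[OF P_diff p_diff] dvg_m[OF uv_diff(2)] Du_def)
  \<comment> \<open>Inside the bracket \<open>P\<close> and \<open>-p\<close> become
    \<open>m * \<zeta> * Du\<close> and \<open>m * \<zeta> * Dv\<close>, so the factor
    \<open>1 / \<zeta>\<close> cancels and leaves divergence terms like those of the transport
    rate.\<close>
  have M: "momentum_source hbar m \<rho> S U t x = - grad P x - \<rho> t x *\<^sub>R grad (U t) x
      + grad (\<lambda>y. (m * \<zeta> * \<rho> t y) * dvg (v t) y) x
      + (1 / \<zeta>) *\<^sub>R ((m * \<zeta> * Du) *\<^sub>R v t x + (m * \<zeta> * Dv) *\<^sub>R u t x
          + ((v t x \<bullet> u t x) * (m * \<rho> t x)) *\<^sub>R u t x)"
    unfolding momentum_source_def Let_def eta_def \<zeta>(2) u_def[symmetric] v_def[symmetric] \<rho>m \<zeta>_def[symmetric]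
    by (simp add: P_def P_u_def[abs_def] p_v_def \<zeta>(2) u_def[symmetric] v_def[symmetric] Du_def Dv_def)
  have a: "dt \<rho> t x = - Dv"
    using continuity by (simp add: Dv_def v_def)
  show ?thesis
  \<comment> \<open>Testing against an arbitrary \<open>h\<close> turns gradients into directional
    derivatives and lets symmetry move each Jacobian onto \<open>h\<close>.\<close>
  proof (rule vector_eq_rdot[THEN iffD1, rule_format])
    fix h
    have E': "dt (\<lambda>\<tau> y. (m * \<rho> \<tau> y) *\<^sub>R u \<tau> y) t x \<bullet> h + m * \<rho> t x * (dt v t x \<bullet> h)
      = - (m * \<rho> t x) * (u t x \<bullet> u' h + v t x \<bullet> v' h)
      - grad P x \<bullet> h - grad p x \<bullet> h - m * Du * (u t x \<bullet> h) - \<rho> t x * (grad (U t) x \<bullet> h)"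
      using arg_cong[OF E, of "\<lambda>z. z \<bullet> h"] by (simp add: inner_add_left N algebra_simps)
    have p'h: "grad p x \<bullet> h = - (m * \<zeta>) * (G x \<bullet> v' h + H h \<bullet> v t x)
      - grad (\<lambda>y. (m * \<zeta> * \<rho> t y) * dvg (v t) y) x \<bullet> h"
      by (subst grad_inner[OF p']) simp
    have Hh: "- \<zeta> * (H h \<bullet> v t x) = (G x \<bullet> h) * (u t x \<bullet> v t x) + \<rho> t x * (u' h \<bullet> v t x)"
      using arg_cong[OF H_eq[of h], of "\<lambda>z. z \<bullet> v t x"] by (simp add: inner_add_left)
    have Gh: "\<zeta> * (G x \<bullet> k) = - \<rho> t x * (u t x \<bullet> k)" for k
      using arg_cong[OF \<rho>u[of x], of "\<lambda>z. z \<bullet> k"] by simp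
    have "u' (u t x + v t x) \<bullet> h = u t x \<bullet> u' h + u' h \<bullet> v t x"
      using u'_sym[of "u t x + v t x" h] by (simp add: inner_add_right inner_commute)
    moreover have "v' (u t x + v t x) \<bullet> h = u t x \<bullet> v' h + v t x \<bullet> v' h"
      using v'_sym[of "u t x + v t x" h] by (simp add: inner_add_right inner_commute)
    \<comment> \<open>The Euler equation cancels the squared-speed terms and the continuity equation
      cancels \<open>Dv\<close> along \<open>v\<close>. The derivative of the inner product of
      \<open>u\<close> and \<open>v\<close> and two crossed divergence terms remain.\<close>
    ultimately have L: "transport_rate (mass_density m \<rho>) (vel_w hbar m \<rho> S) t x \<bullet> h =
        - grad P x \<bullet> h - \<rho> t x * (grad (U t) x \<bullet> h) - grad p x \<bullet> h
        + m * \<rho> t x * (u' h \<bullet> v t x + u t x \<bullet> v' h) + m * Du * (v t x \<bullet> h) + m * Dv * (u t x \<bullet> h)"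
      unfolding T a using E' by (simp add: inner_add_left algebra_simps)
    \<comment> \<open>The last source term is rewritten with the gradient of \<rho>; it matches the
      rank-one contribution of \<open>H_eq\<close> to the gradient of \<open>p\<close>.\<close>
    have "(1 / \<zeta>) * ((v t x \<bullet> u t x) * (m * \<rho> t x) * (u t x \<bullet> h)) = - m * (u t x \<bullet> v t x) * (G x \<bullet> h)"
    proof -
      have "(v t x \<bullet> u t x) * (m * \<rho> t x) * (u t x \<bullet> h) = - m * (u t x \<bullet> v t x) * (\<zeta> * (G x \<bullet> h))"
        unfolding Gh by (simp add: inner_commute)
      then show ?thesis using \<zeta>(1) by simp
    qed
    then have "momentum_source hbar m \<rho> S U t x \<bullet> h =
        - grad P x \<bullet> h - \<rho> t x * (grad (U t) x \<bullet> h)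
        + grad (\<lambda>y. (m * \<zeta> * \<rho> t y) * dvg (v t) y) x \<bullet> h
        + m * Du * (v t x \<bullet> h) + m * Dv * (u t x \<bullet> h) - m * (u t x \<bullet> v t x) * (G x \<bullet> h)"
      unfolding M using \<zeta>(1) by (simp add: inner_add_left inner_diff_left distrib_left)
    moreover have "- (m * \<zeta>) * (G x \<bullet> v' h + H h \<bullet> v t x) =
        m * \<rho> t x * (u t x \<bullet> v' h) + m * ((G x \<bullet> h) * (u t x \<bullet> v t x) + \<rho> t x * (u' h \<bullet> v t x))"
    proof -
      have "- (m * \<zeta>) * (G x \<bullet> v' h + H h \<bullet> v t x) = - m * (\<zeta> * (G x \<bullet> v' h)) + m * (- \<zeta> * (H h \<bullet> v t x))"
        by (simp add: algebra_simps)
      then show ?thesis unfolding Gh Hh by simp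
    qed
    ultimately show "transport_rate (mass_density m \<rho>) (vel_w hbar m \<rho> S) t x \<bullet> h =
        momentum_source hbar m \<rho> S U t x \<bullet> h"
      unfolding L p'h by (simp add: algebra_simps)
  qed
qed

section \<open>The transport theorem for the momentum of the flow\<close>

lemma vel_w_Ck_on_1: "Ck_on 1 (\<lambda>(s, y). vel_w hbar m \<rho> S s y) {(s, y). s \<in> I \<and> y \<in> {x. \<rho> s x > 0}}"
  (is "Ck_on 1 _ ?Z")
proof -
  let ?\<rho> = "\<lambda>(s, y). \<rho> s y" and ?G = "\<lambda>(s, y). grad (\<rho> s) y" and ?V = "\<lambda>(s, y). grad (S s) y"
  have "Ck_on 1 (\<lambda>z. (- zeta hbar m) *\<^sub>R (inverse (?\<rho> z) *\<^sub>R ?G z) + (1 / m) *\<^sub>R ?V z) ?Z"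
    by (intro Ck_on_1_add Ck_on_1_const_scaleR Ck_on_1_scaleR Ck_on_1_inverse
        smooth(1-3)[THEN Ck_on_1_subset]) auto
  moreover have "(\<lambda>(s, y). vel_w hbar m \<rho> S s y) =
      (\<lambda>z. (- zeta hbar m) *\<^sub>R (inverse (?\<rho> z) *\<^sub>R ?G z) + (1 / m) *\<^sub>R ?V z)"
    by (auto simp: fun_eq_iff vel_w_def vel_u_def vel_v_def)
  ultimately show ?thesis by simp
qed

lemma momentum_Ck_on_1:
  "Ck_on 1 (\<lambda>(s, y). mass_density m \<rho> s y *\<^sub>R vel_w hbar m \<rho> S s y) {(s, y). s \<in> I \<and> y \<in> {x. \<rho> s x > 0}}"
proof -
  let ?\<rho> = "\<lambda>(s, y). \<rho> s y" and ?w = "\<lambda>(s, y). vel_w hbar m \<rho> S s y"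
  have "Ck_on 1 (\<lambda>z. m *\<^sub>R (?\<rho> z *\<^sub>R ?w z)) {(s, y). s \<in> I \<and> y \<in> {x. \<rho> s x > 0}}"
    by (intro Ck_on_1_const_scaleR Ck_on_1_scaleR vel_w_Ck_on_1 smooth(1)[THEN Ck_on_1_subset]) auto
  moreover have "(\<lambda>(s, y). mass_density m \<rho> s y *\<^sub>R vel_w hbar m \<rho> S s y) = (\<lambda>z. m *\<^sub>R (?\<rho> z *\<^sub>R ?w z))"
    by (auto simp: fun_eq_iff mass_density_def)
  ultimately show ?thesis by simp
qed

text \<open>A carried region stays where \<rho> is positive, since the motion takes values in the
  domain of the velocity. There Reynolds' theorem applies to the momentum density, and its integrand
  is regrouped by \<open>transport_rate_eq\<close>.\<close>

lemma carried_momentum_derivative: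
  assumes "carried_region (vel_w hbar m \<rho> S) (\<lambda>\<tau>. {x. \<rho> \<tau> x > 0}) I V" and t: "t \<in> I"
  shows "((\<lambda>\<tau>. LINT x:V \<tau>|lebesgue. mass_density m \<rho> \<tau> x *\<^sub>R vel_w hbar m \<rho> S \<tau> x)
    has_vector_derivative
    (LINT x:V t|lebesgue. transport_rate (mass_density m \<rho>) (vel_w hbar m \<rho> S) t x)) (at t)"
proof -
  let ?D = "\<lambda>\<tau>. {x. \<rho> \<tau> x > 0}" and ?w = "vel_w hbar m \<rho> S"
  let ?g = "\<lambda>\<tau> x. mass_density m \<rho> \<tau> x *\<^sub>R ?w \<tau> x"
  obtain t0 \<Omega> X where motion: "motion_on ?w ?D I t0 \<Omega> X"
    and A: "V t0 \<in> sets lebesgue" "bounded (V t0)" "closure (V t0) \<subseteq> \<Omega>"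
    and V: "\<And>\<tau>. \<tau> \<in> I \<Longrightarrow> V \<tau> = X \<tau> ` V t0"
    using assms(1) unfolding carried_region_def by blast
  have "X t ` \<Omega> \<subseteq> ?D t" "open I"
    using motion t unfolding motion_on_def by auto
  moreover have "V t0 \<subseteq> \<Omega>"
    using A(3) closure_subset by (rule order_trans[rotated])
  ultimately have "V t \<subseteq> ?D t"
    using V[OF t] by (metis image_mono order_trans)
  have rate: "dt ?g t y + advect (?w t y) (?g t) y + dvg (?w t) y *\<^sub>R ?g t y =
      transport_rate (mass_density m \<rho>) ?w t y" if "y \<in> V t" for y
  proof -
    have "\<rho> t y > 0" using that \<open>V t \<subseteq> ?D t\<close> by auto
    then obtain u' v' where "(vel_u hbar m \<rho> t has_derivative u') (at y)" "(vel_v m S t has_derivative v') (at y)"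
      using vel_u_deriv vel_v_deriv by metis
    from has_derivative_add[OF this] have "(?w t has_derivative (\<lambda>h. u' h + v' h)) (at y)"
      by (simp add: vel_w_def[abs_def])
    moreover have "mass_density m \<rho> t differentiable at y"
      unfolding mass_density_def by (intro differentiable_mult differentiable_const density_differentiable)
    ultimately show ?thesis by (subst transport_rate_eq) auto
  qed
  have "((\<lambda>\<tau>. LINT x:X \<tau> ` V t0|lebesgue. ?g \<tau> x) has_vector_derivative
      (LINT y:X t ` V t0|lebesgue. dt ?g t y + advect (?w t y) (?g t) y + dvg (?w t) y *\<^sub>R ?g t y)) (at t)"
    by (rule reynolds_transport[OF motion vel_w_Ck_on_1 momentum_Ck_on_1 A t])
  moreover have "(LINT y:V t|lebesgue. dt ?g t y + advect (?w t y) (?g t) y + dvg (?w t) y *\<^sub>R ?g t y) =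
      (LINT y:V t|lebesgue. transport_rate (mass_density m \<rho>) ?w t y)"
    unfolding set_lebesgue_integral_def
    by (intro Bochner_Integration.integral_cong refl) (use rate in \<open>auto simp: indicator_def\<close>)
  ultimately have "((\<lambda>\<tau>. LINT x:X \<tau> ` V t0|lebesgue. ?g \<tau> x) has_vector_derivative
      (LINT y:V t|lebesgue. transport_rate (mass_density m \<rho>) ?w t y)) (at t)"
    using V[OF t] by simp
  then show ?thesis
    by (rule has_vector_derivative_transform_within_open[OF _ \<open>open I\<close> t]) (simp add: V)
qed

end

text \<open>The first conjunct is a genuine time derivative, for regions moving inside the
  positivity set of \<rho>. The second reads the total derivative as the integrated transport
  formula and also covers regions that meet the zeros of \<rho>.\<close>

theorem theorem7:
  fixes hbar m :: real and \<rho> S U :: scalar_field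
  assumes "hbar > 0" and "m > 0"
    and "\<And>t x. \<rho> t x \<ge> 0"
    and "\<And>t. {x. \<rho> t x = 0} \<in> null_sets lebesgue"
    and "regular_flow \<rho> S"
    and "continuity_eq m \<rho> S"
    and "euler_eq hbar m \<rho> S U"
  shows "(\<forall>I V. carried_region (vel_w hbar m \<rho> S) (\<lambda>\<tau>. {x. \<rho> \<tau> x > 0}) I V \<longrightarrow>
            (\<forall>t\<in>I. ((\<lambda>\<tau>. LINT x:V \<tau>|lebesgue. mass_density m \<rho> \<tau> x *\<^sub>R vel_w hbar m \<rho> S \<tau> x)
                      has_vector_derivative
                    (LINT x:V t|lebesgue. momentum_source hbar m \<rho> S U t x)) (at t)))
         \<and> (\<forall>t. \<forall>V\<in>sets lebesgue.
              (LINT x:V|lebesgue. transport_rate (mass_density m \<rho>) (vel_w hbar m \<rho> S) t x)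
              = (LINT x:V|lebesgue. momentum_source hbar m \<rho> S U t x))"
proof -
  \<comment> \<open>Stated for an arbitrary \<open>V\<close>, this serves both conjuncts: carried
    regions are rewritten without first being shown measurable.\<close>
  have eq: "(LINT x:V|lebesgue. transport_rate (mass_density m \<rho>) (vel_w hbar m \<rho> S) t x)
      = (LINT x:V|lebesgue. momentum_source hbar m \<rho> S U t x)" for V t
  proof (rule set_lebesgue_integral_cong_AE_lebesgue)
    have "AE x in lebesgue. x \<notin> {x. \<rho> t x = 0}"
      by (rule AE_not_in[OF assms(4)])
    then have "AE x in lebesgue. \<rho> t x > 0"
      by eventually_elim (use assms(3) in \<open>simp add: less_le\<close>)
    moreover note spec[OF assms(6)[unfolded continuity_eq_def], of t]
    moreover note spec[OF assms(7)[unfolded euler_eq_def Let_def], of t]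
    ultimately show "AE x in lebesgue. transport_rate (mass_density m \<rho>) (vel_w hbar m \<rho> S) t x =
        momentum_source hbar m \<rho> S U t x"
      by eventually_elim (rule transport_rate_eq_momentum_source[OF assms(1,2,3,5)])
  qed
  show ?thesis
    using carried_momentum_derivative[OF assms(1,2,3,5)] unfolding eq by blast
qed

end
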